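(* For every set $A$ of primes, the limit $R_A:=\lim_{n\to\infty}\frac1n\sum_{k\le n}\lambda_A(k)$ exists, and $$R_A=\begin{cases}\displaystyle\prod_{p\in A}\frac{p-1}{p+1}&\text{if }\sum_{p\in A}p^{-1}<\infty,\\[2mm] 0&\text{otherwise.}\end{cases}$$
   Context: For a set $A$ of primes, $\lambda_A$ is the completely multiplicative function with $\lambda_A(p)=-1$ for primes $p\in A$ and $\lambda_A(p)=1$ for primes $p\notin A$; equivalently $\lambda_A(n)=(-1)^{\Omega_A(n)}$ with $\Omega_A(n)$ the number of prime factors of $n$ in $A$, counted with multiplicity. *)

theory Defs
  imports "HOL-Analysis.Analysis" "HOL-Number_Theory.Number_Theory"
begin

definition Omega_in :: "nat set \<Rightarrow> nat \<Rightarrow> nat" where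
  "Omega_in A n = size (filter_mset (\<lambda>p. p \<in> A) (prime_factorization n))"

text \<open>
  Meant for positive arguments. The library sets \<^term>\<open>prime_factorization 0\<close> to the empty
  multiset, so the value at 0 is 1; it is never used.
\<close>

definition liouville_in :: "nat set \<Rightarrow> nat \<Rightarrow> real" where
  "liouville_in A n = (-1) ^ Omega_in A n"

lemma liouville_in_1: "liouville_in A 1 = 1"
  by (simp add: liouville_in_def Omega_in_def)

lemma liouville_in_mult:
  assumes "m > 0" "n > 0"
  shows "liouville_in A (m * n) = liouville_in A m * liouville_in A n"
  using assms
  by (simp add: liouville_in_def Omega_in_def prime_factorization_mult power_add)

lemma liouville_in_prime:
  assumes "prime p"
  shows "liouville_in A p = (if p \<in> A then -1 else 1)"
  using assms
  by (simp add: liouville_in_def Omega_in_def prime_factorization_prime)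

definition liouville_average :: "nat set \<Rightarrow> nat \<Rightarrow> real" where
  "liouville_average A n = (\<Sum>k = 1..n. liouville_in A k) / real n"

definition liouville_mean :: "nat set \<Rightarrow> real" where
  "liouville_mean A = lim (liouville_average A)"

text \<open>
  Infinite products in the library run over all natural numbers, so a product over \<open>A\<close> is
  rendered with factor 1 outside \<open>A\<close>.
\<close>

definition euler_factor_in :: "nat set \<Rightarrow> nat \<Rightarrow> real" where
  "euler_factor_in A p = (if p \<in> A then (real p - 1) / (real p + 1) else 1)"

end

(*
  Convergent case: removing one prime p from A changes the averages M by
  M_A(n) + M_A(n/p)/p = M_A'(n) - M_A'(n/p)/p, which forces the Euler factor (p-1)/(p+1) in the
  limit; a convergent tail of A alters M uniformly little.

  Divergent case (A may be the set of all primes, so this contains the prime number theorem); the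
  argument follows the spirit of Hildebrand's large sieve proof. The dual Turan-Kubilius inequality
  gives M(n) = lambda_A(p) M(n/p) up to a small error for most primes p, in the sense of 1/p-weights.
  Cut the logarithmic scale into bins of width eps. By Selberg's formula a bin far out contains at
  most a fixed multiple of the expected number of primes, uniformly in eps. So if |M| took 300
  separated values at points n_0, ..., n_299 of [n, n^(1+eta)], then by pigeonhole two of the
  translated sets of good primes would meet in some bin, giving n_i/p close to n_j/q and hence
  |M(n_i)| close to |M(n_j)|. Thus |M| is nearly constant on [n, n^(1+eta)]. If it stayed away from 0
  there, M would have constant sign and the logarithmic sums of lambda_A would grow like ln n over this
  range; but these are o(ln n), since each prime of A costs a factor (p-1)/(p+1).
*)
theory Submission
  imports Defs "HOL-Computational_Algebra.Squarefree"
begin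

text \<open>Why \<open>M\<close> enters in absolute value: the Turan-Kubilius relation carries the
  sign lambda_A(p), which varies with p, so comparing y_i/p with y_j/q says nothing about the signs
  of the averages. The sign is recovered only at the end, from the small steps of \<open>M\<close>.
  Why Selberg's formula: the bins must be narrow so that the averages hardly move inside one, but
  Chebyshev's bounds alone do not make the number of primes in a bin shrink with eps. Selberg's
  formula bounds the 1/p-weight of bin k by 5/k for every eps, with only the starting point
  depending on eps. Where 300 comes from: primes between e^a and e^(8^J a) have 1/p-weight at least
  J/4, and J is so large that each y_i keeps good primes of weight at least J/8. If the translates
  never met, all y_i together would fit into bins of total capacity at most 30 J, which fails for
  300 points since 300/8 > 30. The elementary estimates used give 1/4 per factor 8 instead of the
  true ln 8, hence the large number. J depends on the tolerance alone, so eta does not depend on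
  n.\<close>

section \<open>Double sums over pairs with bounded product\<close>

lemma sum_dirichlet_hyperbola:
  fixes h :: "nat \<Rightarrow> nat \<Rightarrow> 'a :: comm_monoid_add"
  assumes "x \<ge> (0::real)"
  shows "(\<Sum>d\<in>{1..nat \<lfloor>x\<rfloor>}. \<Sum>n\<in>{1..nat \<lfloor>x / real d\<rfloor>}. h d n) =
         (\<Sum>m\<in>{1..nat \<lfloor>x\<rfloor>}. \<Sum>d | d dvd m. h d (m div d))"
proof -
  have fin: "finite {d. d dvd m}" if "m \<in> {1..nat \<lfloor>x\<rfloor>}" for m :: nat
    using that by auto
  have le: "n \<le> nat \<lfloor>x / real d\<rfloor> \<longleftrightarrow> d * n \<le> nat \<lfloor>x\<rfloor>" if "d \<ge> 1" for d n :: nat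
    using that assms
    by (simp add: le_nat_iff le_floor_iff pos_le_divide_eq mult.commute)
  have "(\<Sum>(d, n)\<in>(SIGMA d:{1..nat \<lfloor>x\<rfloor>}. {1..nat \<lfloor>x / real d\<rfloor>}). h d n) =
        (\<Sum>(m, d)\<in>(SIGMA m:{1..nat \<lfloor>x\<rfloor>}. {d. d dvd m}). h d (m div d))"
  proof (rule sum.reindex_bij_witness[where
        i = "\<lambda>(m, d). (d, m div d)" and j = "\<lambda>(d, n). (d * n, d)"], goal_cases)
    case (4 b)
    then obtain m d where b: "b = (m, d)" "1 \<le> m" "m \<le> nat \<lfloor>x\<rfloor>" "d dvd m" by auto
    from b obtain e where e: "m = d * e" by blast
    with b have "d \<ge> 1" "e \<ge> 1" by (auto intro: Suc_leI Nat.gr0I)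
    moreover have "d \<le> nat \<lfloor>x\<rfloor>"
      using b dvd_imp_le[of d m] by linarith
    ultimately show ?case using b e le[of d e] by (auto simp: mult.commute)
  qed (auto simp: le)
  thus ?thesis
    by (simp add: sum.Sigma fin del: One_nat_def)
qed

lemma sum_dirichlet_swap:
  fixes h :: "nat \<Rightarrow> nat \<Rightarrow> 'a :: comm_monoid_add"
  assumes "x \<ge> (0::real)"
  shows "(\<Sum>d\<in>{1..nat \<lfloor>x\<rfloor>}. \<Sum>n\<in>{1..nat \<lfloor>x / real d\<rfloor>}. h d n) =
         (\<Sum>n\<in>{1..nat \<lfloor>x\<rfloor>}. \<Sum>d\<in>{1..nat \<lfloor>x / real n\<rfloor>}. h d n)"
proof -
  have le: "n \<le> nat \<lfloor>x / real d\<rfloor> \<longleftrightarrow> d * n \<le> nat \<lfloor>x\<rfloor>" if "d \<ge> 1" for d n :: nat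
    using that assms
    by (simp add: le_nat_iff le_floor_iff pos_le_divide_eq mult.commute)
  have le': "d \<le> nat \<lfloor>x / real n\<rfloor> \<longleftrightarrow> d * n \<le> nat \<lfloor>x\<rfloor>" if "n \<ge> 1" for d n :: nat
    using le[OF that] by (simp add: mult.commute)
  have *: "d \<le> nat \<lfloor>x\<rfloor>" "n \<le> nat \<lfloor>x\<rfloor>" if "d * n \<le> nat \<lfloor>x\<rfloor>" "Suc 0 \<le> n" "Suc 0 \<le> d" for d n
  proof -
    have "d \<le> d * n" "n \<le> d * n" using that by auto
    thus "d \<le> nat \<lfloor>x\<rfloor>" "n \<le> nat \<lfloor>x\<rfloor>" using that(1) by linarith+
  qed
  have "(\<Sum>(d, n)\<in>(SIGMA d:{1..nat \<lfloor>x\<rfloor>}. {1..nat \<lfloor>x / real d\<rfloor>}). h d n) =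
        (\<Sum>(n, d)\<in>(SIGMA n:{1..nat \<lfloor>x\<rfloor>}. {1..nat \<lfloor>x / real n\<rfloor>}). h d n)"
    by (rule sum.reindex_bij_witness[where i = "\<lambda>(n, d). (d, n)" and j = "\<lambda>(d, n). (n, d)"])
       (auto simp: le le' mult.commute[of _ "_ :: nat"] intro: *)
  thus ?thesis
    by (simp add: sum.Sigma)
qed

subsection \<open>The Moebius function\<close>

definition moebius_mu :: "nat \<Rightarrow> real" where
  "moebius_mu n = (if squarefree n then (-1) ^ card (prime_factors n) else 0)"

lemma abs_moebius_le_1: "\<bar>moebius_mu n\<bar> \<le> 1"
  by (simp add: moebius_mu_def power_abs)

lemma moebius_prime_mult:
  assumes "prime p" "\<not> p dvd d"
  shows "moebius_mu (p * d) = - moebius_mu d"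
proof (cases "d = 0")
  case False
  have cop: "coprime p d"
    using assms prime_imp_coprime by blast
  have sq: "squarefree (p * d) \<longleftrightarrow> squarefree d"
    using squarefree_mult_coprime[OF cop] squarefree_prime[OF assms(1)] squarefree_multD(2)[of p d] by blast
  have "prime_factors (p * d) = insert p (prime_factors d)"
    using assms False by (auto simp: prime_factors_product prime_factorization_prime)
  moreover have "p \<notin> prime_factors d"
    using assms by auto
  ultimately show ?thesis
    using sq by (simp add: moebius_mu_def)
qed (use assms in auto)

text \<open>For a prime \<open>p\<close> dividing \<open>n\<close>, each divisor \<open>d\<close>
  prime to \<open>p\<close> cancels against \<open>p * d\<close>. The remaining divisors are
  multiples of \<open>p ^ 2\<close>, where \<open>moebius_mu\<close> vanishes.\<close>

lemma sum_moebius_divisors: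
  assumes "n > (0::nat)"
  shows "(\<Sum>d | d dvd n. moebius_mu d) = (if n = 1 then 1 else 0)"
proof (cases "n = 1")
  case True
  thus ?thesis by (simp add: moebius_mu_def)
next
  case False
  then obtain p where p: "prime p" "p dvd n"
    using prime_factor_nat by blast
  define D where "D = {d. d dvd n \<and> \<not> p dvd d}"
  have finD: "finite {d. d dvd n}" using assms by auto
  have fD: "finite D" unfolding D_def by (rule finite_subset[OF _ finD]) auto
  have sub: "D \<union> (\<lambda>d. p * d) ` D \<subseteq> {d. d dvd n}"
  proof -
    have "p * d dvd n" if "d dvd n" "\<not> p dvd d" for d
      using p that by (meson divides_mult prime_imp_coprime)
    thus ?thesis by (auto simp: D_def)
  qed
  have "(\<Sum>d | d dvd n. moebius_mu d) = (\<Sum>d\<in>D \<union> (\<lambda>d. p * d) ` D. moebius_mu d)"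
  proof (rule sum.mono_neutral_right[OF finD sub], intro ballI)
    fix d assume d: "d \<in> {d. d dvd n} - (D \<union> (\<lambda>d. p * d) ` D)"
    then obtain e where e: "d = p * e" by (auto simp: D_def elim!: dvdE)
    have "e \<notin> D" using d e by auto
    hence "p dvd e" using d e dvd_mult_right by (auto simp: D_def)
    hence "p ^ 2 dvd d" by (simp add: e power2_eq_square)
    hence "\<not> squarefree d" using p(1)
      by (metis not_prime_unit squarefree_def)
    thus "moebius_mu d = 0" by (simp add: moebius_mu_def)
  qed
  also have "\<dots> = (\<Sum>d\<in>D. moebius_mu d) + (\<Sum>d\<in>(\<lambda>d. p * d) ` D. moebius_mu d)"
    by (rule sum.union_disjoint) (use fD in \<open>auto simp: D_def\<close>)
  also have "(\<Sum>d\<in>(\<lambda>d. p * d) ` D. moebius_mu d) = (\<Sum>d\<in>D. moebius_mu (p * d))"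
    using p(1) by (subst sum.reindex) (auto intro!: inj_onI simp: prime_gt_0_nat)
  also have "\<dots> = (\<Sum>d\<in>D. - moebius_mu d)"
    by (intro sum.cong refl moebius_prime_mult) (use p in \<open>auto simp: D_def\<close>)
  finally show ?thesis using False by (simp add: sum_negf)
qed

text \<open>The argument \<open>x / d / n\<close> depends only on m = d n, so
  \<open>h (x / m)\<close> receives the sum of \<open>moebius_mu\<close> over the divisors of m as
  its coefficient.\<close>

lemma moebius_inversion:
  fixes h :: "real \<Rightarrow> real"
  assumes "x \<ge> 1"
  shows "(\<Sum>d\<in>{1..nat \<lfloor>x\<rfloor>}. moebius_mu d * (\<Sum>n\<in>{1..nat \<lfloor>x / real d\<rfloor>}. h (x / real d / real n))) = h x"
proof -
  have "(\<Sum>d\<in>{1..nat \<lfloor>x\<rfloor>}. moebius_mu d * (\<Sum>n\<in>{1..nat \<lfloor>x / real d\<rfloor>}. h (x / real d / real n))) =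
        (\<Sum>m\<in>{1..nat \<lfloor>x\<rfloor>}. \<Sum>d | d dvd m. moebius_mu d * h (x / real d / real (m div d)))"
    unfolding sum_distrib_left using assms by (intro sum_dirichlet_hyperbola) auto
  also have "\<dots> = (\<Sum>m\<in>{1..nat \<lfloor>x\<rfloor>}. (\<Sum>d | d dvd m. moebius_mu d) * h (x / real m))"
    unfolding sum_distrib_right
    by (intro sum.cong refl) (auto elim!: dvdE simp: field_simps)
  also have "\<dots> = (\<Sum>m\<in>{1..nat \<lfloor>x\<rfloor>}. if m = 1 then h x else 0)"
    by (intro sum.cong refl) (auto simp: sum_moebius_divisors)
  also have "\<dots> = h x"
    using assms by (subst sum.delta) (auto simp: le_nat_iff le_floor_iff)
  finally show ?thesis .
qed

subsection \<open>Chebyshev and Mertens estimates\<close>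

definition chebyshev_psi :: "real \<Rightarrow> real" where
  "chebyshev_psi x = (\<Sum>n\<in>{1..nat \<lfloor>x\<rfloor>}. mangoldt n)"

text \<open>The logarithm of the factorial of the floor of \<open>x\<close>, the quantity that
  Chebyshev's method expands in prime powers.\<close>

definition sum_ln :: "real \<Rightarrow> real" where
  "sum_ln x = (\<Sum>n\<in>{1..nat \<lfloor>x\<rfloor>}. ln (real n))"

lemma chebyshev_psi_mono: "x \<le> y \<Longrightarrow> chebyshev_psi x \<le> chebyshev_psi y"
  unfolding chebyshev_psi_def
  by (intro sum_mono2) (auto simp: mangoldt_nonneg intro: order_trans nat_mono floor_mono)

lemma chebyshev_psi_nonneg: "chebyshev_psi x \<ge> 0"
  unfolding chebyshev_psi_def by (intro sum_nonneg mangoldt_nonneg)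

lemma sum_mangoldt_mult_div:
  assumes "x \<ge> 0"
  shows "(\<Sum>n\<in>{1..nat \<lfloor>x\<rfloor>}. mangoldt n * real (nat \<lfloor>x / real n\<rfloor>)) = sum_ln x"
proof -
  have "(\<Sum>n\<in>{1..nat \<lfloor>x\<rfloor>}. mangoldt n * real (nat \<lfloor>x / real n\<rfloor>)) =
        (\<Sum>d\<in>{1..nat \<lfloor>x\<rfloor>}. \<Sum>n\<in>{1..nat \<lfloor>x / real d\<rfloor>}. mangoldt d)"
    by (simp add: mult.commute)
  also have "\<dots> = (\<Sum>m\<in>{1..nat \<lfloor>x\<rfloor>}. \<Sum>d | d dvd m. mangoldt d)"
    by (rule sum_dirichlet_hyperbola[OF assms])
  also have "\<dots> = sum_ln x"
    unfolding sum_ln_def by (intro sum.cong refl) (simp add: mangoldt_sum)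
  finally show ?thesis .
qed

lemma sum_chebyshev_psi:
  assumes "x \<ge> 0"
  shows "(\<Sum>n\<in>{1..nat \<lfloor>x\<rfloor>}. chebyshev_psi (x / real n)) = sum_ln x"
  unfolding chebyshev_psi_def
  by (subst sum_dirichlet_swap[OF assms], subst sum_mangoldt_mult_div[OF assms, symmetric])
     (simp add: mult.commute)

lemma sum_ln_nat_bounds:
  assumes "N > 0"
  shows "real N * ln (real N) - real N \<le> (\<Sum>n\<in>{1..N}. ln (real n))"
    and "(\<Sum>n\<in>{1..N}. ln (real n)) \<le> real N * ln (real N) - real N + 1 + ln (real N)"
proof -
  have step: "real n * (ln (real (Suc n)) - ln (real n)) \<le> 1 \<and>
              1 \<le> real (Suc n) * (ln (real (Suc n)) - ln (real n))" if "n > 0" for n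
  proof -
    have "ln (real (Suc n)) - ln (real n) \<le> (real (Suc n) - real n) / real n"
      using that by (intro ln_diff_le) auto
    moreover have "ln (real n) - ln (real (Suc n)) \<le> (real n - real (Suc n)) / real (Suc n)"
      using that by (intro ln_diff_le) auto
    ultimately show ?thesis using that by (auto simp: field_simps)
  qed
  show "real N * ln (real N) - real N \<le> (\<Sum>n\<in>{1..N}. ln (real n))"
    using assms
  proof (induction N rule: nat_induct_non_zero)
    case (Suc n)
    with step[of n] show ?case by (simp add: algebra_simps)
  qed auto
  show "(\<Sum>n\<in>{1..N}. ln (real n)) \<le> real N * ln (real N) - real N + 1 + ln (real N)"
    using assms
  proof (induction N rule: nat_induct_non_zero)
    case (Suc n)
    with step[of n] show ?case by (simp add: algebra_simps)
  qed auto
qed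

lemma sum_ln_bounds:
  assumes "x \<ge> 1"
  shows "x * ln x - x - ln x \<le> sum_ln x" and "sum_ln x \<le> x * ln x - x + 1 + ln x"
proof -
  define N where "N = nat \<lfloor>x\<rfloor>"
  have N: "N > 0" "real N \<le> x" "x < real N + 1"
    using assms unfolding N_def by linarith+
  have "ln x - ln (real N) \<le> (x - real N) / real N"
    using N assms by (intro ln_diff_le) auto
  hence 1: "real N * (ln x - ln (real N)) \<le> x - real N"
    using N by (simp add: field_simps)
  have "ln (real N) - ln x \<le> (real N - x) / x"
    using N assms by (intro ln_diff_le) auto
  hence "(x - real N) / x \<le> ln x - ln (real N)"
    by (simp add: diff_divide_distrib)
  hence 2: "real N * (x - real N) / x \<le> real N * (ln x - ln (real N))"
    using mult_left_mono[of _ _ "real N"] by fastforce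
  have "ln 1 - ln x \<le> (1 - x) / x"
    using assms by (intro ln_diff_le) auto
  hence "ln x \<ge> 1 - 1 / x" using assms by (simp add: field_simps)
  moreover have "1 / x \<le> real N / x" using N assms by (intro divide_right_mono) auto
  \<comment> \<open>Expanded, this says that the upper estimate for \<open>N * ln N - N\<close>
    obtained from fact 2 does not exceed \<open>x * ln x - x\<close>.\<close>
  ultimately have "(x - real N) * (ln x + real N / x - 1) \<ge> 0"
    using N by (intro mult_nonneg_nonneg) auto
  hence 3: "(x - real N) * ln x + real N * (x - real N) / x - (x - real N) \<ge> 0"
    by (simp add: algebra_simps diff_divide_distrib)
  have 4: "(x - real N) * ln x \<le> 1 * ln x"
    using N assms by (intro mult_right_mono) auto
  have 5: "ln (real N) \<le> ln x" using N by simp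
  have "real N * ln (real N) - real N \<le> sum_ln x"
       "sum_ln x \<le> real N * ln (real N) - real N + 1 + ln (real N)"
    using sum_ln_nat_bounds[OF N(1)] unfolding sum_ln_def N_def by auto
  thus "x * ln x - x - ln x \<le> sum_ln x" "sum_ln x \<le> x * ln x - x + 1 + ln x"
    using 1 2 3 4 5 by (simp_all add: algebra_simps)
qed

text \<open>Chebyshev's device: on the right, \<open>mangoldt n\<close> has the coefficient floor(t)
  - 2 floor(t/2) with t = x/n. It is never negative, and it equals 1 for 1 <= t < 2, that is, for
  x/2 < n <= x.\<close>

lemma chebyshev_psi_half:
  assumes "x \<ge> 2"
  shows "chebyshev_psi x - chebyshev_psi (x / 2) \<le> sum_ln x - 2 * sum_ln (x / 2)"
proof -
  have sub: "nat \<lfloor>x / 2\<rfloor> \<le> nat \<lfloor>x\<rfloor>"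
    using assms by (intro nat_mono floor_mono) auto
  have extend: "(\<Sum>n\<in>{1..nat \<lfloor>x / 2\<rfloor>}. g n) = (\<Sum>n\<in>{1..nat \<lfloor>x\<rfloor>}. if real n \<le> x / 2 then g n else 0)"
    for g :: "nat \<Rightarrow> real"
    by (rule sum.mono_neutral_cong_left)
       (use sub assms in \<open>auto simp: le_nat_iff le_floor_iff\<close>)
  have "x / 2 \<ge> 0" "x \<ge> 0" using assms by auto
  note * = this[THEN sum_mangoldt_mult_div, symmetric]
  have half: "sum_ln (x / 2) = (\<Sum>n\<in>{1..nat \<lfloor>x\<rfloor>}. mangoldt n * real (nat \<lfloor>x / 2 / real n\<rfloor>))"
    unfolding *(1) extend
  proof (intro sum.cong refl)
    fix n assume "n \<in> {1..nat \<lfloor>x\<rfloor>}"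
    hence "x / 2 / real n < 1" if "\<not> real n \<le> x / 2"
      using that by (simp add: field_simps)
    hence "nat \<lfloor>x / 2 / real n\<rfloor> = 0" if "\<not> real n \<le> x / 2"
      using that by (simp add: floor_less_iff)
    thus "(if real n \<le> x / 2 then mangoldt n * real (nat \<lfloor>x / 2 / real n\<rfloor>) else 0) =
      mangoldt n * real (nat \<lfloor>x / 2 / real n\<rfloor>)" by auto
  qed
  have "chebyshev_psi x - chebyshev_psi (x / 2) =
        (\<Sum>n\<in>{1..nat \<lfloor>x\<rfloor>}. mangoldt n * (if real n \<le> x / 2 then 0 else 1))"
    unfolding chebyshev_psi_def extend
    unfolding sum_subtractf[symmetric] by (intro sum.cong) auto
  also have "\<dots> \<le> (\<Sum>n\<in>{1..nat \<lfloor>x\<rfloor>}. mangoldt n *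
                 (real (nat \<lfloor>x / real n\<rfloor>) - 2 * real (nat \<lfloor>x / 2 / real n\<rfloor>)))"
  proof (intro sum_mono mult_left_mono mangoldt_nonneg)
    fix n assume n: "n \<in> {1..nat \<lfloor>x\<rfloor>}"
    define t where "t = x / real n"
    have t: "t \<ge> 1" "real n \<le> x / 2 \<longleftrightarrow> 2 \<le> t" "x / 2 / real n = t / 2"
      using n assms by (auto simp: t_def le_nat_iff le_floor_iff field_simps)
    show "(if real n \<le> x / 2 then 0 else 1) \<le> real (nat \<lfloor>x / real n\<rfloor>) - 2 * real (nat \<lfloor>x / 2 / real n\<rfloor>)"
    proof -
      have "real (nat \<lfloor>t\<rfloor>) = of_int \<lfloor>t\<rfloor>" "real (nat \<lfloor>t / 2\<rfloor>) = of_int \<lfloor>t / 2\<rfloor>"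
        using t(1) by auto
      moreover have "2 * \<lfloor>t / 2\<rfloor> \<le> \<lfloor>t\<rfloor>" by linarith
      moreover have "\<lfloor>t / 2\<rfloor> = 0" if "t < 2" using that t(1) by (simp add: floor_eq_iff)
      moreover have "\<lfloor>t\<rfloor> \<ge> 1" using t(1) by simp
      ultimately show ?thesis unfolding t t_def[symmetric] by (cases "2 \<le> t") auto
    qed
  qed
  also have "\<dots> = sum_ln x - 2 * sum_ln (x / 2)"
    unfolding half *(2)
    by (simp add: sum_subtractf right_diff_distrib sum_distrib_left mult.left_commute)
  finally show ?thesis .
qed

text \<open>In \<open>sum_ln x - 2 * sum_ln (x / 2)\<close> the terms \<open>x * ln x\<close>
  cancel, so halving the argument costs at most \<open>5 * x\<close>. The costs form a geometric
  series with sum \<open>10 * x\<close>.\<close>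

lemma chebyshev_psi_le:
  assumes "x \<ge> 0"
  shows "chebyshev_psi x \<le> 10 * x"
proof -
  have half: "chebyshev_psi x \<le> chebyshev_psi (x / 2) + 5 * x" if "x \<ge> 2" for x
  proof -
    have "sum_ln x - 2 * sum_ln (x / 2) \<le> (x * ln x - x + 1 + ln x) - 2 * (x / 2 * ln (x / 2) - x / 2 - ln (x / 2))"
    proof -
      have "x \<ge> 1" "x / 2 \<ge> 1" using that by auto
      thus ?thesis by (intro diff_mono mult_left_mono sum_ln_bounds) auto
    qed
    also have "\<dots> = x * ln 2 + 1 + ln x + 2 * (ln x - ln 2)"
      using that by (simp add: ln_div algebra_simps)
    also have "\<dots> \<le> x * 1 + 1 + (x - 1) + 2 * (x - 1)"
    proof -
      define l where "l = ln (2::real)"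
      have "0 < l" "l \<le> 1" using ln2_le_25_over_36 by (auto simp: l_def)
      moreover have "ln x \<le> x - 1" using that ln_le_minus_one[of x] by simp
      moreover define xl where "xl = x * l"
      moreover have "xl \<le> x * 1" unfolding xl_def using that \<open>l \<le> 1\<close> by (intro mult_left_mono) auto
      ultimately show ?thesis unfolding l_def[symmetric] xl_def[symmetric] by simp
    qed
    also have "\<dots> \<le> 5 * x" using that by simp
    finally show ?thesis using chebyshev_psi_half[OF that] by linarith
  qed
  have "x < 2 ^ n \<Longrightarrow> x \<ge> 0 \<Longrightarrow> chebyshev_psi x \<le> 10 * x" for n
  proof (induction n arbitrary: x)
    case 0
    hence "nat \<lfloor>x\<rfloor> = 0" by (simp add: floor_less_iff)
    thus ?case using 0 by (simp add: chebyshev_psi_def)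
  next
    case (Suc n)
    show ?case
    proof (cases "x \<ge> 2")
      case True
      have "chebyshev_psi (x / 2) \<le> 10 * (x / 2)" using Suc by (intro Suc.IH) auto
      with half[OF True] show ?thesis by simp
    next
      case False
      hence "nat \<lfloor>x\<rfloor> \<le> 1" by linarith
      hence "{1..nat \<lfloor>x\<rfloor>} \<subseteq> {1}" by auto
      hence "chebyshev_psi x \<le> (\<Sum>n\<in>{1::nat}. mangoldt n)"
        unfolding chebyshev_psi_def by (intro sum_mono2) (auto simp: mangoldt_nonneg)
      thus ?thesis using Suc by simp
    qed
  qed
  moreover obtain n where "x < 2 ^ n" using real_arch_pow[of 2 x] by auto
  ultimately show ?thesis using assms by blast
qed

text \<open>Mertens' first theorem. Replacing the floor of x/n by x/n in
  \<open>sum_mangoldt_mult_div\<close> changes the sum by at most \<open>chebyshev_psi x\<close>,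
  which is O(x); then divide by \<open>x\<close>.\<close>

lemma sum_mangoldt_over_bounds:
  assumes "x \<ge> 1"
  shows "\<bar>(\<Sum>n\<in>{1..nat \<lfloor>x\<rfloor>}. mangoldt n / real n) - ln x\<bar> \<le> 13"
proof -
  define E where "E = (\<Sum>n\<in>{1..nat \<lfloor>x\<rfloor>}. mangoldt n * (x / real n - real (nat \<lfloor>x / real n\<rfloor>)))"
  have fl: "0 \<le> x / real n - real (nat \<lfloor>x / real n\<rfloor>) \<and> x / real n - real (nat \<lfloor>x / real n\<rfloor>) \<le> 1" for n
    using assms by (simp, linarith)
  have "E \<ge> 0" unfolding E_def using fl by (intro sum_nonneg mult_nonneg_nonneg mangoldt_nonneg) auto
  moreover have "E \<le> (\<Sum>n\<in>{1..nat \<lfloor>x\<rfloor>}. mangoldt n * 1)"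
    unfolding E_def using fl by (intro sum_mono mult_left_mono mangoldt_nonneg) auto
  hence "E \<le> 10 * x" using chebyshev_psi_le[of x] assms by (simp add: chebyshev_psi_def)
  moreover have "E = x * (\<Sum>n\<in>{1..nat \<lfloor>x\<rfloor>}. mangoldt n / real n) - sum_ln x"
  proof -
    have "x \<ge> 0" using assms by simp
    thus ?thesis unfolding E_def sum_mangoldt_mult_div[of x, symmetric, OF \<open>x \<ge> 0\<close>]
    by (simp add: right_diff_distrib sum_subtractf sum_distrib_left mult_ac)
  qed
  moreover note sum_ln_bounds[OF assms]
  moreover have "ln x \<le> x" using ln_le_minus_one[of x] assms by simp
  ultimately have "\<bar>x * (\<Sum>n\<in>{1..nat \<lfloor>x\<rfloor>}. mangoldt n / real n) - x * ln x\<bar> \<le> 13 * x"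
    using assms by linarith
  hence "x * \<bar>(\<Sum>n\<in>{1..nat \<lfloor>x\<rfloor>}. mangoldt n / real n) - ln x\<bar> \<le> x * 13"
    using assms by (simp add: abs_mult right_diff_distrib[symmetric])
  thus ?thesis using assms by (subst (asm) mult_le_cancel_left_pos) auto
qed

subsection \<open>Selberg's formula\<close>

lemma harm_ln_euler_mascheroni_bound:
  assumes "x \<ge> 1"
  shows "\<bar>(\<Sum>n\<in>{1..nat \<lfloor>x\<rfloor>}. 1 / real n) - ln x - euler_mascheroni\<bar> \<le> 2 / x"
proof -
  define N where "N = nat \<lfloor>x\<rfloor>"
  have N: "N > 0" "real N \<le> x" "x < real N + 1"
    using assms unfolding N_def by linarith+
  obtain k where k: "N = Suc k" using N by (cases N) auto
  have H: "(\<Sum>n\<in>{1..N}. 1 / real n) = harm N"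
    by (simp add: harm_def field_simps)
  have "euler_mascheroni \<ge> harm N - ln (real N + 1) + 1 / (2 * (real N + 1))"
       "euler_mascheroni \<le> harm N - ln (real N + 1) + 1 / (2 * real N)"
    using euler_mascheroni_lower[of k] euler_mascheroni_upper[of k] by (simp_all add: k add_ac)
  moreover have "1 / (2 * real N) \<le> 1 / x" "0 \<le> 1 / (2 * (real N + 1))"
    using N assms k by (auto intro!: divide_left_mono)
  moreover have "ln x \<le> ln (real N + 1)" using N assms by simp
  moreover have "ln (real N + 1) - ln x \<le> (real N + 1 - x) / x"
    using N assms by (intro ln_diff_le) auto
  moreover have "(real N + 1 - x) / x \<le> 1 / x" using N assms by (intro divide_right_mono) auto
  moreover have "2 / x = 1 / x + 1 / x" by simp
  ultimately show ?thesis unfolding N_def[symmetric] H by linarith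
qed

text \<open>
  The constant is the one for which the linear terms cancel in the sum of
  \<open>psi_remainder (x / n)\<close> over \<open>n \<le> x\<close>, leaving an error of size \<open>O(ln x)\<close>.
\<close>

definition psi_remainder :: "real \<Rightarrow> real" where
  "psi_remainder x = chebyshev_psi x - x + euler_mascheroni + 1"

lemma euler_mascheroni_less_1: "euler_mascheroni < (1::real)"
  using euler_mascheroni_less_13_over_22 by simp

lemma sum_psi_remainder_bound:
  assumes "x \<ge> 1"
  shows "\<bar>\<Sum>n\<in>{1..nat \<lfloor>x\<rfloor>}. psi_remainder (x / real n)\<bar> \<le> 5 + ln x"
proof -
  define H where "H = (\<Sum>n\<in>{1..nat \<lfloor>x\<rfloor>}. 1 / real n)"
  define N where "N = real (nat \<lfloor>x\<rfloor>)"
  have N: "N \<le> x" "x < N + 1" using assms unfolding N_def by linarith+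
  have eq: "(\<Sum>n\<in>{1..nat \<lfloor>x\<rfloor>}. psi_remainder (x / real n)) = sum_ln x - x * H + (euler_mascheroni + 1) * N"
    using sum_chebyshev_psi[of x] assms
    by (simp add: psi_remainder_def sum.distrib sum_subtractf H_def N_def sum_distrib_left algebra_simps)
  have "\<bar>x * (H - ln x - euler_mascheroni)\<bar> \<le> x * (2 / x)"
    unfolding abs_mult using harm_ln_euler_mascheroni_bound[OF assms] assms
    by (intro mult_mono) (auto simp: H_def)
  hence "\<bar>x * H - x * ln x - euler_mascheroni * x\<bar> \<le> 2"
    using assms by (simp add: algebra_simps)
  moreover have "\<bar>sum_ln x - (x * ln x - x)\<bar> \<le> 1 + ln x"
    using sum_ln_bounds[OF assms] ln_ge_zero[OF assms] by linarith
  moreover have "\<bar>(euler_mascheroni + 1) * (x - N)\<bar> \<le> 2 * 1"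
    unfolding abs_mult using N euler_mascheroni_less_1 euler_mascheroni_pos
    by (intro mult_mono) auto
  hence "\<bar>(euler_mascheroni * x + x) - (euler_mascheroni + 1) * N\<bar> \<le> 2"
    by (simp add: algebra_simps)
  ultimately show ?thesis unfolding eq by linarith
qed

text \<open>Trades the squared logarithm for a power below 1, so that the bounds at x/d, summed over
  d <= x, total O(x). The constant is 5 * 2 + 4 * 4, from \<open>ln x \<le> 2 * sqrt x\<close> and
  \<open>ln x \<le> 4 * u\<close> with \<open>u\<close> the fourth root.\<close>

lemma ln_mult_bound_sqrt:
  assumes "x \<ge> (1::real)"
  shows "ln x * (5 + ln x) \<le> 26 * sqrt x"
proof -
  define u where "u = sqrt (sqrt x)"
  have u: "u \<ge> 1" "x = u ^ 4" "sqrt x = u ^ 2"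
    using assms by (auto simp: u_def power4_eq_xxxx) (simp add: power2_eq_square[symmetric] mult.assoc)?
  have "ln x = 4 * ln u" using u by (simp add: ln_realpow)
  moreover have "ln u \<le> u" "0 \<le> ln u" using ln_le_minus_one[of u] u by auto
  ultimately have "ln x \<le> 4 * u" "0 \<le> ln x" by auto
  hence "ln x * ln x \<le> (4 * u) * (4 * u)" by (intro mult_mono) auto
  moreover have "ln x = 2 * ln (sqrt x)" using assms by (simp add: ln_sqrt)
  hence "ln x \<le> 2 * sqrt x" using ln_le_minus_one[of "sqrt x"] assms by simp
  ultimately show ?thesis using u by (simp add: algebra_simps power2_eq_square)
qed

lemma sum_inverse_sqrt_le: "(\<Sum>n\<in>{1..N}. 1 / sqrt (real n)) \<le> 2 * sqrt (real N)"
proof (induction N)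
  case (Suc n)
  have "sqrt (real n) * sqrt (real (Suc n)) \<le> (real n + real (Suc n)) / 2"
    by (rule arith_geo_mean_sqrt[unfolded real_sqrt_mult]) auto
  hence "1 / sqrt (real (Suc n)) \<le> 2 * sqrt (real (Suc n)) - 2 * sqrt (real n)"
    by (simp add: field_simps)
  with Suc show ?case by simp
qed auto

text \<open>
  Tatuzawa and Iseki: summed over \<open>x / n\<close>, the left-hand side collapses to \<open>ln x\<close> times the
  sum of \<open>psi_remainder (x / n)\<close>, since the divisor sum of the von Mangoldt function is \<open>ln\<close>;
  Moebius inversion then bounds the left-hand side itself.
\<close>

lemma selberg_remainder_bound:
  assumes "x \<ge> 1"
  shows "\<bar>psi_remainder x * ln x + (\<Sum>n\<in>{1..nat \<lfloor>x\<rfloor>}. mangoldt n * psi_remainder (x / real n))\<bar> \<le> 52 * x"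
proof -
  define h where "h = (\<lambda>x. psi_remainder x * ln x + (\<Sum>n\<in>{1..nat \<lfloor>x\<rfloor>}. mangoldt n * psi_remainder (x / real n)))"
  define G where "G = (\<lambda>x. ln x * (\<Sum>n\<in>{1..nat \<lfloor>x\<rfloor>}. psi_remainder (x / real n)))"
  have sum_h: "(\<Sum>n\<in>{1..nat \<lfloor>x\<rfloor>}. h (x / real n)) = G x" if "x \<ge> 1" for x
  proof -
    have "(\<Sum>n\<in>{1..nat \<lfloor>x\<rfloor>}. \<Sum>d\<in>{1..nat \<lfloor>x / real n\<rfloor>}. mangoldt d * psi_remainder (x / real n / real d)) =
          (\<Sum>d\<in>{1..nat \<lfloor>x\<rfloor>}. \<Sum>n\<in>{1..nat \<lfloor>x / real d\<rfloor>}. mangoldt d * psi_remainder (x / real n / real d))"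
      using that by (intro sum_dirichlet_swap) auto
    also have "\<dots> = (\<Sum>m\<in>{1..nat \<lfloor>x\<rfloor>}. \<Sum>d | d dvd m. mangoldt d * psi_remainder (x / real (m div d) / real d))"
      using that by (intro sum_dirichlet_hyperbola) auto
    also have "\<dots> = (\<Sum>m\<in>{1..nat \<lfloor>x\<rfloor>}. (\<Sum>d | d dvd m. mangoldt d) * psi_remainder (x / real m))"
      unfolding sum_distrib_right
      by (intro sum.cong refl) (auto elim!: dvdE simp: field_simps)
    also have "\<dots> = (\<Sum>m\<in>{1..nat \<lfloor>x\<rfloor>}. ln (real m) * psi_remainder (x / real m))"
      by (intro sum.cong refl) (simp add: mangoldt_sum)
    finally have "(\<Sum>n\<in>{1..nat \<lfloor>x\<rfloor>}. h (x / real n)) =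
        (\<Sum>n\<in>{1..nat \<lfloor>x\<rfloor>}. psi_remainder (x / real n) * ln (x / real n) + ln (real n) * psi_remainder (x / real n))"
      by (simp add: h_def sum.distrib)
    also have "\<dots> = (\<Sum>n\<in>{1..nat \<lfloor>x\<rfloor>}. ln x * psi_remainder (x / real n))"
      using that by (intro sum.cong refl) (auto simp: ln_div algebra_simps)
    finally show ?thesis by (simp add: G_def sum_distrib_left)
  qed
  have G_bound: "\<bar>G x\<bar> \<le> 26 * sqrt x" if "x \<ge> 1" for x
  proof -
    have "\<bar>G x\<bar> \<le> ln x * (5 + ln x)"
      unfolding G_def abs_mult using that sum_psi_remainder_bound[OF that]
      by (intro mult_mono) auto
    thus ?thesis using ln_mult_bound_sqrt[OF that] by linarith
  qed
  have ge1: "x / real d \<ge> 1" if "d \<in> {1..nat \<lfloor>x\<rfloor>}" for d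
    using that assms by (auto simp: le_nat_iff le_floor_iff field_simps)
  have "h x = (\<Sum>d\<in>{1..nat \<lfloor>x\<rfloor>}. moebius_mu d * (\<Sum>n\<in>{1..nat \<lfloor>x / real d\<rfloor>}. h (x / real d / real n)))"
    by (simp only: moebius_inversion[OF assms])
  also have "\<dots> = (\<Sum>d\<in>{1..nat \<lfloor>x\<rfloor>}. moebius_mu d * G (x / real d))"
    by (intro sum.cong refl) (simp only: sum_h ge1)
  also have "\<bar>\<dots>\<bar> \<le> (\<Sum>d\<in>{1..nat \<lfloor>x\<rfloor>}. 1 * (26 * sqrt (x / real d)))"
    unfolding abs_mult[symmetric]
    by (rule order.trans[OF sum_abs], intro sum_mono, unfold abs_mult, intro mult_mono)
       (use ge1 G_bound abs_moebius_le_1 in auto)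
  also have "\<dots> = 26 * sqrt x * (\<Sum>d\<in>{1..nat \<lfloor>x\<rfloor>}. 1 / sqrt (real d))"
    by (simp add: sum_distrib_left real_sqrt_divide)
  also have "\<dots> \<le> 26 * sqrt x * (2 * sqrt x)"
    using order.trans[OF sum_inverse_sqrt_le, of "nat \<lfloor>x\<rfloor>" "2 * sqrt x"] assms
    by (intro mult_left_mono) auto
  also have "\<dots> = 52 * x" using assms by simp
  finally show ?thesis by (simp add: h_def)
qed

definition selberg_sum :: "real \<Rightarrow> real" where
  "selberg_sum x = chebyshev_psi x * ln x + (\<Sum>n\<in>{1..nat \<lfloor>x\<rfloor>}. mangoldt n * chebyshev_psi (x / real n))"

text \<open>Substituting \<open>chebyshev_psi\<close> by \<open>psi_remainder\<close> plus its
  linear terms leaves the main term x ln x twice: once directly, and once from the sum of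
  \<open>mangoldt n / n\<close> by Mertens. The errors are 52 x from the remainder, 13 x from
  Mertens and at most 22 x from the constant part of \<open>psi_remainder\<close>.\<close>

lemma selberg_formula:
  assumes "x \<ge> 1"
  shows "\<bar>selberg_sum x - 2 * x * ln x\<bar> \<le> 100 * x"
proof -
  define S where "S = (\<Sum>n\<in>{1..nat \<lfloor>x\<rfloor>}. mangoldt n / real n)"
  define R where "R = psi_remainder x * ln x + (\<Sum>n\<in>{1..nat \<lfloor>x\<rfloor>}. mangoldt n * psi_remainder (x / real n))"
  define Q where "Q = (euler_mascheroni + 1) * (ln x + chebyshev_psi x)"
  have "selberg_sum x = R + x * ln x + x * S - Q"
    by (simp add: selberg_sum_def R_def Q_def psi_remainder_def S_def chebyshev_psi_def sum.distrib
        sum_subtractf sum_distrib_left algebra_simps)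
  moreover have "\<bar>R\<bar> \<le> 52 * x" using selberg_remainder_bound[OF assms] by (simp add: R_def)
  moreover have "\<bar>x * S - x * ln x\<bar> \<le> x * 13"
    using sum_mangoldt_over_bounds[OF assms] assms
    unfolding right_diff_distrib[symmetric] abs_mult S_def by (intro mult_mono) auto
  moreover have "Q \<le> 2 * (x + 10 * x)" unfolding Q_def
    using euler_mascheroni_less_1 euler_mascheroni_pos chebyshev_psi_le[of x] assms
      ln_le_minus_one[of x] chebyshev_psi_nonneg[of x]
    by (intro mult_mono add_mono) auto
  moreover have "0 \<le> Q" unfolding Q_def
    using euler_mascheroni_pos assms chebyshev_psi_nonneg[of x] by (intro mult_nonneg_nonneg) auto
  moreover define D where "D = x * S - x * ln x"
  ultimately have "\<bar>D\<bar> \<le> x * 13" "selberg_sum x - 2 * x * ln x = R + D - Q" by simp_all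
  with \<open>\<bar>R\<bar> \<le> 52 * x\<close> \<open>0 \<le> Q\<close> \<open>Q \<le> 2 * (x + 10 * x)\<close> show ?thesis using assms by simp
qed

text \<open>Both summands of \<open>selberg_sum\<close> are nondecreasing, so the increment of the
  first is at most that of the whole. The price is a main term twice the expected one.\<close>

lemma chebyshev_psi_short_interval:
  assumes "1 \<le> y" "y \<le> z"
  shows "(chebyshev_psi z - chebyshev_psi y) * ln y \<le> 2 * (z * ln z - y * ln y) + 100 * (y + z)"
proof -
  have "(\<Sum>n\<in>{1..nat \<lfloor>y\<rfloor>}. mangoldt n * chebyshev_psi (y / real n)) \<le>
        (\<Sum>n\<in>{1..nat \<lfloor>y\<rfloor>}. mangoldt n * chebyshev_psi (z / real n))"
    using assms by (intro sum_mono mult_left_mono mangoldt_nonneg chebyshev_psi_mono divide_right_mono) auto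
  also have "\<dots> \<le> (\<Sum>n\<in>{1..nat \<lfloor>z\<rfloor>}. mangoldt n * chebyshev_psi (z / real n))"
    using assms nat_mono[OF floor_mono[OF assms(2)]]
    by (intro sum_mono2) (auto intro!: mult_nonneg_nonneg mangoldt_nonneg chebyshev_psi_nonneg)
  finally have "chebyshev_psi z * ln z - chebyshev_psi y * ln y \<le> selberg_sum z - selberg_sum y"
    by (simp add: selberg_sum_def)
  moreover have "chebyshev_psi z * ln y \<le> chebyshev_psi z * ln z"
    using assms by (intro mult_left_mono chebyshev_psi_nonneg) auto
  moreover have "\<bar>selberg_sum z - 2 * z * ln z\<bar> \<le> 100 * z" "\<bar>selberg_sum y - 2 * y * ln y\<bar> \<le> 100 * y"
    using assms by (auto intro!: selberg_formula)
  ultimately show ?thesis by (simp add: algebra_simps abs_le_iff)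
qed

subsection \<open>Sums over reciprocals of primes\<close>

lemma finite_primes_le: "finite {p :: nat. P p \<and> real p \<le> b}"
  by (rule finite_subset[of _ "{..nat \<lfloor>b\<rfloor>}"]) (auto simp: le_nat_floor)

lemma sum_ln_primes_le_psi_diff:
  assumes "0 \<le> y" "y \<le> z"
  shows "(\<Sum>p | prime p \<and> y < real p \<and> real p \<le> z. ln (real p)) \<le> chebyshev_psi z - chebyshev_psi y"
proof -
  have le: "nat \<lfloor>y\<rfloor> \<le> nat \<lfloor>z\<rfloor>" using assms by (intro nat_mono floor_mono)
  have "(\<Sum>p | prime p \<and> y < real p \<and> real p \<le> z. ln (real p)) =
        (\<Sum>p | prime p \<and> y < real p \<and> real p \<le> z. mangoldt p)"
    by (intro sum.cong) auto
  also have "\<dots> \<le> (\<Sum>n\<in>{1..nat \<lfloor>z\<rfloor>} - {1..nat \<lfloor>y\<rfloor>}. mangoldt n)"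
  proof (intro sum_mono2 subsetI)
    fix p assume p: "p \<in> {p. prime p \<and> y < real p \<and> real p \<le> z}"
    hence "p \<le> nat \<lfloor>z\<rfloor>" by (simp add: le_nat_floor)
    moreover have "\<not> p \<le> nat \<lfloor>y\<rfloor>"
      using p assms by (auto simp: le_nat_iff le_floor_iff)
    ultimately show "p \<in> {1..nat \<lfloor>z\<rfloor>} - {1..nat \<lfloor>y\<rfloor>}"
      using p by (auto simp: prime_ge_Suc_0_nat)
  qed (auto simp: mangoldt_nonneg)
  also have "\<dots> = chebyshev_psi z - chebyshev_psi y"
    unfolding chebyshev_psi_def using le by (subst sum_diff) auto
  finally show ?thesis .
qed

text \<open>The expected weight of the bin is about ln((k+1)/k), roughly 1/k. What matters later is
  that 5 is independent of \<open>\<epsilon>\<close>; only \<open>K\<close> depends on it. The 5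
  consists of a factor 2 from Selberg's formula, a factor 2 from
  \<open>z - y \<le> 2 * \<epsilon> * y\<close>, and 1 for lower-order terms.\<close>

lemma brun_titchmarsh_log_bins:
  assumes "0 < \<epsilon>" "\<epsilon> \<le> 1"
  shows "\<exists>K>0. \<forall>k\<ge>K. (\<Sum>p | prime p \<and> exp (\<epsilon> * real k) < real p \<and> real p \<le> exp (\<epsilon> * real (Suc k)). 1 / real p) \<le> 5 / real k"
proof -
  \<comment> \<open>From this \<open>K\<close> on, the lower-order terms
    \<open>6 * \<epsilon> * y\<close> and \<open>400 * y\<close> of the short interval bound
    together are at most \<open>\<epsilon>\<close> times \<open>\<epsilon> * k * y\<close>.\<close>
  define K where "K = nat \<lceil>(6 + 400 / \<epsilon>) / \<epsilon>\<rceil> + 1"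
  have "(\<Sum>p | prime p \<and> exp (\<epsilon> * real k) < real p \<and> real p \<le> exp (\<epsilon> * real (Suc k)). 1 / real p) \<le> 5 / real k"
    if k: "k \<ge> K" for k
  proof -
    define y where "y = exp (\<epsilon> * real k)"
    define z where "z = exp (\<epsilon> * real (Suc k))"
    define W where "W = chebyshev_psi z - chebyshev_psi y"
    have k1: "k \<ge> 1" using k by (simp add: K_def)
    have "(6 + 400 / \<epsilon>) / \<epsilon> \<le> real K" unfolding K_def by linarith
    hence "(6 + 400 / \<epsilon>) / \<epsilon> \<le> real k" using k by linarith
    hence k2: "(6 + 400 / \<epsilon>) / real k \<le> \<epsilon>" using k1 assms by (simp add: field_simps)
    have z: "z = exp \<epsilon> * y" by (simp add: y_def z_def exp_add[symmetric] algebra_simps)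
    have y: "y > 0" "ln y = \<epsilon> * real k" "y \<ge> 1" using assms by (auto simp: y_def)
    have lnz: "ln z = \<epsilon> * real k + \<epsilon>" by (simp add: z_def algebra_simps)
    have "exp \<epsilon> \<le> 1 + \<epsilon> + \<epsilon>\<^sup>2" using exp_bound[of \<epsilon>] assms by simp
    moreover have "\<epsilon>\<^sup>2 \<le> \<epsilon>" using assms by (simp add: power2_eq_square mult_left_le)
    ultimately have e: "exp \<epsilon> \<le> 1 + 2 * \<epsilon>" "exp \<epsilon> \<ge> 1" "exp \<epsilon> \<le> 3" using assms by auto
    have zy: "y \<le> z" "z \<le> 3 * y" "z - y \<le> 2 * \<epsilon> * y"
      using e y mult_right_mono[OF e(1), of y] unfolding z by (auto simp: algebra_simps)
    have "W * ln y \<le> 2 * (z * ln z - y * ln y) + 100 * (y + z)"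
      unfolding W_def using y zy by (intro chebyshev_psi_short_interval) auto
    also have "z * ln z - y * ln y = (z - y) * (\<epsilon> * real k) + z * \<epsilon>"
      unfolding lnz y by (simp add: algebra_simps)
    also have "2 * ((z - y) * (\<epsilon> * real k) + z * \<epsilon>) + 100 * (y + z) \<le>
               2 * ((2 * \<epsilon> * y) * (\<epsilon> * real k) + (3 * y) * \<epsilon>) + 100 * (4 * y)"
      using zy assms y by (intro add_mono mult_left_mono mult_right_mono) auto
    also have "\<dots> = \<epsilon> * real k * y * (4 * \<epsilon> + (6 + 400 / \<epsilon>) / real k)"
      using assms k1 by (simp add: field_simps)
    also have "\<dots> \<le> \<epsilon> * real k * y * (5 * \<epsilon>)"
      using k2 assms y by (intro mult_left_mono) auto
    finally have W: "W \<le> 5 * \<epsilon> * y"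
      using assms k1 unfolding y by (simp add: field_simps)
    have "(\<Sum>p | prime p \<and> y < real p \<and> real p \<le> z. 1 / real p) \<le>
          (\<Sum>p | prime p \<and> y < real p \<and> real p \<le> z. ln (real p) / (\<epsilon> * real k * y))"
    proof (intro sum_mono)
      fix p assume "p \<in> {p. prime p \<and> y < real p \<and> real p \<le> z}"
      hence p: "y < real p" by auto
      have "\<epsilon> * real k \<le> ln (real p)" using p y by (metis exp_le_cancel_iff exp_ln less_eq_real_def order_less_trans y_def)
      hence "\<epsilon> * real k * y \<le> ln (real p) * real p"
        using p y assms by (intro mult_mono) auto
      thus "1 / real p \<le> ln (real p) / (\<epsilon> * real k * y)"
        using p y assms k1 by (simp add: field_simps)
    qed
    also have "\<dots> = (\<Sum>p | prime p \<and> y < real p \<and> real p \<le> z. ln (real p)) / (\<epsilon> * real k * y)"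
      by (simp add: sum_divide_distrib)
    also have "\<dots> \<le> W / (\<epsilon> * real k * y)"
      unfolding W_def using y zy assms by (intro divide_right_mono sum_ln_primes_le_psi_diff) auto
    also have "\<dots> \<le> (5 * \<epsilon> * y) / (\<epsilon> * real k * y)"
      using W y assms by (intro divide_right_mono) auto
    also have "\<dots> = 5 / real k" using y assms by simp
    finally show ?thesis by (simp add: y_def z_def)
  qed
  moreover have "K > 0" by (simp add: K_def)
  ultimately show ?thesis by blast
qed

lemma sum_ln_primes_over_upper:
  assumes "x \<ge> 1"
  shows "(\<Sum>p | prime p \<and> real p \<le> x. ln (real p) / real p) \<le> ln x + 13"
proof -
  have "(\<Sum>p | prime p \<and> real p \<le> x. ln (real p) / real p) = (\<Sum>p | prime p \<and> real p \<le> x. mangoldt p / real p)"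
    by (intro sum.cong) auto
  also have "\<dots> \<le> (\<Sum>n\<in>{1..nat \<lfloor>x\<rfloor>}. mangoldt n / real n)"
    by (intro sum_mono2) (auto simp: le_nat_floor mangoldt_nonneg prime_ge_Suc_0_nat)
  also have "\<dots> \<le> ln x + 13" using sum_mangoldt_over_bounds[OF assms] by linarith
  finally show ?thesis .
qed

text \<open>The powers of \<open>p\<close> contribute a geometric series of ratio 1/p <= 1/2, so
  \<open>p\<close> itself carries at least half of their total in Mertens' estimate. This crude
  halving avoids a separate bound for higher prime powers.\<close>

lemma sum_ln_primes_over_lower:
  assumes "x \<ge> 1"
  shows "ln x - 13 \<le> 2 * (\<Sum>p | prime p \<and> real p \<le> x. ln (real p) / real p)"
proof -
  define N where "N = nat \<lfloor>x\<rfloor>"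
  define P where "P = {p :: nat. prime p \<and> real p \<le> x}"
  have finP: "finite P" unfolding P_def by (rule finite_primes_le)
  have "ln x - 13 \<le> (\<Sum>n\<in>{1..N}. mangoldt n / real n)"
    using sum_mangoldt_over_bounds[OF assms] unfolding N_def by linarith
  also have "\<dots> \<le> (\<Sum>n\<in>(\<lambda>(p, k). p ^ k) ` (P \<times> {1..N}). mangoldt n / real n)"
  proof -
    \<comment> \<open>Exponents up to \<open>N\<close> suffice, since k < p^k <= N. The product set
      also yields powers beyond \<open>N\<close>, which only enlarge the sum.\<close>
    have mem: "n \<in> (\<lambda>(p, k). p ^ k) ` (P \<times> {1..N})" if n: "n \<in> {1..N}" "mangoldt n \<noteq> (0::real)" for n
    proof -
      have "primepow n" using n by (auto simp: mangoldt_def split: if_splits)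
      then obtain p k where pk: "prime p" "k > 0" "n = p ^ k" by (auto simp: primepow_def)
      have "p \<le> n" using pk by (simp add: self_le_power prime_ge_Suc_0_nat)
      moreover have "k \<le> n" using pk prime_gt_1_nat[OF pk(1)]
        power_gt_expt[of p k] by simp
      moreover have "real p \<le> x"
      proof -
        have "p \<le> N" using \<open>p \<le> n\<close> n by simp
        thus ?thesis using assms unfolding N_def by linarith
      qed
      ultimately show ?thesis using pk n
        by (intro image_eqI[of _ _ "(p, k)"]) (auto simp: P_def)
    qed
    have "(\<Sum>n\<in>{1..N}. mangoldt n / real n) = (\<Sum>n\<in>{1..N} \<inter> (\<lambda>(p, k). p ^ k) ` (P \<times> {1..N}). mangoldt n / real n)"
    proof (rule sum.mono_neutral_right; (intro ballI)?)
      fix n assume "n \<in> {1..N} - {1..N} \<inter> (\<lambda>(p, k). p ^ k) ` (P \<times> {1..N})"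
      with mem[of n] have "mangoldt n = (0 :: real)" by blast
      thus "mangoldt n / real n = 0" by simp
    qed auto
    also have "\<dots> \<le> (\<Sum>n\<in>(\<lambda>(p, k). p ^ k) ` (P \<times> {1..N}). mangoldt n / real n)"
      using finP by (intro sum_mono2) (auto simp: mangoldt_nonneg)
    finally show ?thesis .
  qed
  also have "\<dots> \<le> (\<Sum>pk\<in>P \<times> {1..N}. mangoldt (fst pk ^ snd pk) / real (fst pk ^ snd pk))"
    using finP
    by (intro order.trans[OF sum_image_le] sum_mono)
       (auto simp: mangoldt_nonneg case_prod_beta)
  also have "\<dots> = (\<Sum>p\<in>P. \<Sum>k\<in>{1..N}. ln (real p) * (1 / real p) ^ k)"
    by (subst sum.cartesian_product') (auto intro!: sum.cong simp: P_def power_one_over divide_simps)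
  also have "\<dots> \<le> (\<Sum>p\<in>P. 2 * (ln (real p) / real p))"
  proof (intro sum_mono)
    fix p assume "p \<in> P"
    hence p: "prime p" "p \<ge> 2" by (auto simp: P_def prime_ge_2_nat)
    define q where "q = 1 / real p"
    have q: "0 < q" "q \<le> 1 / 2" using p by (auto simp: q_def field_simps)
    have "(\<Sum>k\<in>{1..N}. q ^ k) \<le> 2 * q"
    proof -
      have "(1 - q) * (\<Sum>k\<in>{1..N}. q ^ k) = q - q ^ Suc N"
      proof (induction N)
        case (Suc N)
        have "(1 - q) * (\<Sum>k\<in>{1..Suc N}. q ^ k) = (1 - q) * (\<Sum>k\<in>{1..N}. q ^ k) + (1 - q) * q ^ Suc N"
          by (simp add: distrib_left)
        also have "\<dots> = q - q ^ Suc (Suc N)" unfolding Suc.IH by (simp add: algebra_simps)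
        finally show ?case .
      qed auto
      also have "\<dots> \<le> q" using q by simp
      finally have "(\<Sum>k\<in>{1..N}. q ^ k) \<le> q / (1 - q)" using q by (simp add: field_simps)
      also have "\<dots> \<le> q / (1 / 2)" using q by (intro divide_left_mono) auto
      finally show ?thesis by simp
    qed
    hence "ln (real p) * (\<Sum>k\<in>{1..N}. q ^ k) \<le> ln (real p) * (2 * q)"
      using p by (intro mult_left_mono) auto
    thus "(\<Sum>k\<in>{1..N}. ln (real p) * (1 / real p) ^ k) \<le> 2 * (ln (real p) / real p)"
      by (simp add: sum_distrib_left q_def mult_ac)
  qed
  finally show ?thesis by (simp add: sum_distrib_left P_def)
qed

text \<open>The lower Mertens bound has lost a factor 2, so the window must be wide: (8a - 13)/2 -
  (a + 13) = 3a - 39/2 is at least 2a once a >= 20. Dividing by the largest logarithm 8a gives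
  1/4.\<close>

lemma sum_inverse_primes_lower:
  assumes "a \<ge> 20"
  shows "(\<Sum>p | prime p \<and> exp a < real p \<and> real p \<le> exp (8 * a). 1 / real p) \<ge> 1 / 4"
proof -
  define L where "L = (\<lambda>x. \<Sum>p | prime p \<and> real p \<le> x. ln (real p) / real p)"
  have "L (exp (8 * a)) - L (exp a) = (\<Sum>p | prime p \<and> exp a < real p \<and> real p \<le> exp (8 * a). ln (real p) / real p)"
  proof -
    have "exp a \<le> exp (8 * a)" using assms by simp
    hence sub: "{p :: nat. prime p \<and> real p \<le> exp a} \<subseteq> {p. prime p \<and> real p \<le> exp (8 * a)}"
      by (intro Collect_mono) linarith
    have eq: "{p. prime p \<and> exp a < real p \<and> real p \<le> exp (8 * a)} =
          {p. prime p \<and> real p \<le> exp (8 * a)} - {p. prime p \<and> real p \<le> exp a}"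
      by (auto simp: not_le)
    show ?thesis unfolding L_def eq
      by (rule sum_diff[symmetric, OF finite_primes_le sub])
  qed
  also have "\<dots> \<le> (\<Sum>p | prime p \<and> exp a < real p \<and> real p \<le> exp (8 * a). (8 * a) * (1 / real p))"
  proof (intro sum_mono)
    fix p assume "p \<in> {p. prime p \<and> exp a < real p \<and> real p \<le> exp (8 * a)}"
    hence p: "prime p" "real p \<le> exp (8 * a)" by auto
    hence "ln (real p) \<le> 8 * a"
      by (metis ln_exp ln_le_cancel_iff exp_gt_zero of_nat_0_less_iff prime_gt_0_nat)
    thus "ln (real p) / real p \<le> (8 * a) * (1 / real p)" by (simp add: divide_right_mono)
  qed
  also have "\<dots> = (8 * a) * (\<Sum>p | prime p \<and> exp a < real p \<and> real p \<le> exp (8 * a). 1 / real p)"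
    by (simp only: sum_distrib_left)
  finally have *: "L (exp (8 * a)) - L (exp a) \<le> \<dots>" .
  have "8 * a - 13 \<le> 2 * L (exp (8 * a))"
    using sum_ln_primes_over_lower[of "exp (8 * a)"] assms by (simp add: L_def)
  moreover have "L (exp a) \<le> a + 13"
    using sum_ln_primes_over_upper[of "exp a"] assms by (simp add: L_def)
  ultimately have "(8 * a) * (1 / 4) \<le> L (exp (8 * a)) - L (exp a)"
    using assms by simp
  from order.trans[OF this *] show ?thesis
    using assms by (subst (asm) mult_le_cancel_left_pos) auto
qed

subsection \<open>Weighted sums over multiples\<close>

lemma sum_multiples:
  fixes g :: "nat \<Rightarrow> 'a :: comm_monoid_add"
  assumes "d > 0"
  shows "(\<Sum>k | k \<in> {1..n} \<and> d dvd k. g k) = (\<Sum>m\<in>{1..n div d}. g (d * m))"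
  by (rule sum.reindex_bij_witness[where i = "\<lambda>m. d * m" and j = "\<lambda>k. k div d"])
     (use assms in \<open>auto simp: div_le_mono less_eq_div_iff_mult_less_eq mult.commute Suc_le_eq elim!: dvdE\<close>)

lemma abs_liouville_in [simp]: "\<bar>liouville_in A k\<bar> = 1"
  by (simp add: liouville_in_def power_abs)

lemma liouville_in_cong:
  assumes "\<And>p. prime p \<Longrightarrow> p dvd k \<Longrightarrow> p \<in> A \<longleftrightarrow> p \<in> B"
  shows "liouville_in A k = liouville_in B k"
proof -
  have "filter_mset (\<lambda>p. p \<in> A) (prime_factorization k) = filter_mset (\<lambda>p. p \<in> B) (prime_factorization k)"
    using assms by (intro filter_mset_cong refl) auto
  thus ?thesis by (simp add: liouville_in_def Omega_in_def)
qed

text \<open>The weight is kept general because the same splitting serves ordinary sums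
  (\<open>w\<close> constantly 1) and logarithmic sums (\<open>w k = 1 / k\<close>).\<close>

lemma liouville_weighted_sum_split:
  fixes w :: "nat \<Rightarrow> real"
  assumes "prime p" and w: "\<And>m. m > 0 \<Longrightarrow> w (p * m) = w p * w m"
  shows "(\<Sum>k = 1..n. liouville_in A k * w k) =
         (\<Sum>k | k \<in> {1..n} \<and> \<not> p dvd k. liouville_in A k * w k) +
         liouville_in A p * w p * (\<Sum>k = 1..n div p. liouville_in A k * w k)"
proof -
  have p: "p > 0" using assms by (simp add: prime_gt_0_nat)
  have "(\<Sum>k = 1..n. liouville_in A k * w k) =
        (\<Sum>k | k \<in> {1..n} \<and> \<not> p dvd k. liouville_in A k * w k) +
        (\<Sum>k | k \<in> {1..n} \<and> p dvd k. liouville_in A k * w k)"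
    by (subst sum.union_disjoint[symmetric]) (auto intro!: sum.cong)
  also have "(\<Sum>k | k \<in> {1..n} \<and> p dvd k. liouville_in A k * w k) =
             (\<Sum>m = 1..n div p. liouville_in A (p * m) * w (p * m))"
    by (rule sum_multiples[OF p])
  also have "\<dots> = (\<Sum>m = 1..n div p. liouville_in A p * w p * (liouville_in A m * w m))"
  proof (intro sum.cong refl)
    fix m assume "m \<in> {1..n div p}"
    hence "m > 0" by simp
    from liouville_in_mult[OF p this] w[OF this]
    show "liouville_in A (p * m) * w (p * m) = liouville_in A p * w p * (liouville_in A m * w m)" by simp
  qed
  also have "\<dots> = liouville_in A p * w p * (\<Sum>k = 1..n div p. liouville_in A k * w k)"
    by (simp add: sum_distrib_left)
  finally show ?thesis .
qed

text \<open>Away from multiples of \<open>p\<close> the functions for \<open>A\<close> and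
  \<open>A - {p}\<close> agree, so both splittings share that part; they differ in the sign at
  \<open>p\<close>.\<close>

lemma liouville_weighted_sum_remove_prime:
  fixes w :: "nat \<Rightarrow> real"
  assumes "prime p" "p \<in> A" and w: "\<And>m. m > 0 \<Longrightarrow> w (p * m) = w p * w m"
  shows "(\<Sum>k = 1..n. liouville_in A k * w k) + w p * (\<Sum>k = 1..n div p. liouville_in A k * w k) =
         (\<Sum>k = 1..n. liouville_in (A - {p}) k * w k) - w p * (\<Sum>k = 1..n div p. liouville_in (A - {p}) k * w k)"
proof -
  have "(\<Sum>k | k \<in> {1..n} \<and> \<not> p dvd k. liouville_in A k * w k) =
        (\<Sum>k | k \<in> {1..n} \<and> \<not> p dvd k. liouville_in (A - {p}) k * w k)"
    by (intro sum.cong refl arg_cong2[of _ _ _ _ "(*)"] liouville_in_cong) auto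
  moreover note liouville_weighted_sum_split[OF assms(1), where w = w and A = A and n = n, OF w]
    liouville_weighted_sum_split[OF assms(1), where w = w and A = "A - {p}" and n = n, OF w]
  ultimately show ?thesis
    using assms(1,2) by (simp add: liouville_in_prime)
qed

subsection \<open>Mean values for a convergent sum of reciprocals\<close>

definition liouville_sum :: "nat set \<Rightarrow> nat \<Rightarrow> real" where
  "liouville_sum A n = (\<Sum>k = 1..n. liouville_in A k)"

lemma liouville_average_altdef: "liouville_average A n = liouville_sum A n / real n"
  by (simp add: liouville_average_def liouville_sum_def)

lemma abs_liouville_sum_diff_le:
  assumes "m \<le> n"
  shows "\<bar>liouville_sum A n - liouville_sum A m\<bar> \<le> real n - real m"
proof -
  have "liouville_sum A n - liouville_sum A m = (\<Sum>k\<in>{1..n} - {1..m}. liouville_in A k)"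
    unfolding liouville_sum_def using assms by (subst sum_diff) auto
  also have "{1..n} - {1..m} = {m<..n}" by auto
  also have "\<bar>\<Sum>k\<in>{m<..n}. liouville_in A k\<bar> \<le> (\<Sum>k\<in>{m<..n}. \<bar>liouville_in A k\<bar>)"
    by (rule sum_abs)
  finally show ?thesis using assms by simp
qed

lemma abs_liouville_sum_le: "\<bar>liouville_sum A n\<bar> \<le> real n"
  using abs_liouville_sum_diff_le[of 0 n A] by (simp add: liouville_sum_def)

lemma abs_liouville_average_le: "\<bar>liouville_average A n\<bar> \<le> 1"
  using abs_liouville_sum_le[of A n] by (auto simp: liouville_average_altdef divide_le_eq)

lemma liouville_sum_remove_prime:
  assumes "prime p" "p \<in> A"
  shows "liouville_sum A n + liouville_sum A (n div p) =
         liouville_sum (A - {p}) n - liouville_sum (A - {p}) (n div p)"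
  using liouville_weighted_sum_remove_prime[OF assms, of "\<lambda>_. 1" n] by (simp add: liouville_sum_def)

text \<open>Iterating \<open>n \<mapsto> n div p\<close> halves the initial bound \<open>B\<close>
  each time. The accumulated errors stay below r/2, because (r/2)/2 + r/4 = r/2. This gives
  convergence itself, not only the value of a limit assumed to exist.\<close>

lemma tendsto_0_div_contraction:
  fixes D \<delta> :: "nat \<Rightarrow> real"
  assumes p: "p \<ge> 2" and B: "\<And>n. \<bar>D n\<bar> \<le> B" and \<delta>: "\<delta> \<longlonglongrightarrow> 0"
    and D: "\<And>n. n > 0 \<Longrightarrow> \<bar>D n\<bar> \<le> \<bar>D (n div p)\<bar> / 2 + \<delta> n"
  shows "D \<longlonglongrightarrow> 0"
proof (rule LIMSEQ_I)
  fix r :: real assume r: "r > 0"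
  obtain N0 where N0: "\<And>n. n \<ge> N0 \<Longrightarrow> \<bar>\<delta> n\<bar> < r / 4"
    using LIMSEQ_D[OF \<delta>, of "r / 4"] r by auto
  define N where "N = max N0 1"
  have step: "n \<ge> N * p ^ j \<Longrightarrow> \<bar>D n\<bar> \<le> B / 2 ^ j + r / 2" for n j
  proof (induction j arbitrary: n)
    case 0
    thus ?case using B[of n] r by simp
  next
    case (Suc j)
    have "n div p \<ge> N * p ^ j" using Suc.prems p
      by (simp add: less_eq_div_iff_mult_less_eq mult_ac)
    hence IH: "\<bar>D (n div p)\<bar> \<le> B / 2 ^ j + r / 2" by (rule Suc.IH)
    have "N * p ^ Suc j \<ge> N * 1" using p by (intro mult_left_mono) auto
    hence "n \<ge> N" using Suc.prems by linarith
    hence "n > 0" "\<bar>\<delta> n\<bar> < r / 4" using N0[of n] by (auto simp: N_def)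
    moreover define b where "b = B / 2 ^ j"
    ultimately have "\<bar>D n\<bar> \<le> b / 2 + r / 2"
      using D[OF \<open>n > 0\<close>] IH unfolding b_def[symmetric] by linarith
    thus ?case by (simp add: b_def mult.commute)
  qed
  have "B \<ge> 0" using B[of 0] by linarith
  obtain j where j: "2 * B / r < 2 ^ j" using real_arch_pow[of 2 "2 * B / r"] by auto
  hence "B / 2 ^ j < r / 2" using r by (simp add: field_simps)
  hence "\<forall>n\<ge>N * p ^ j. norm (D n - 0) < r"
  proof (intro allI impI)
    fix n assume "n \<ge> N * p ^ j"
    from step[OF this] \<open>B / 2 ^ j < r / 2\<close> show "norm (D n - 0) < r"
      unfolding real_norm_def by linarith
  qed
  thus "\<exists>no. \<forall>n\<ge>no. norm (D n - 0) < r" by blast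
qed

lemma tendsto_div_over:
  assumes "p > 0"
  shows "(\<lambda>n. real (n div p) / real n) \<longlonglongrightarrow> 1 / real p"
proof (rule tendsto_sandwich)
  have "(1 / real p - 1 / real n) \<le> real (n div p) / real n \<and> real (n div p) / real n \<le> 1 / real p" if "n > 0" for n
  proof -
    have "n = p * (n div p) + n mod p" by simp
    hence eq: "real n = real p * real (n div p) + real (n mod p)" by (metis of_nat_add of_nat_mult)
    moreover have "real (n mod p) \<le> real p" using assms by (simp add: less_imp_le)
    ultimately have "real n \<le> real p * real (n div p) + real p" "real p * real (n div p) \<le> real n"
      by auto
    hence "real n / real p - 1 \<le> real (n div p)" "real (n div p) \<le> real n / real p"
      using assms by (simp_all add: field_simps)
    hence "(real n / real p - 1) / real n \<le> real (n div p) / real n"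
          "real (n div p) / real n \<le> real n / real p / real n"
      by (intro divide_right_mono; simp)+
    thus ?thesis using that by (simp add: diff_divide_distrib)
  qed
  thus "\<forall>\<^sub>F n in sequentially. 1 / real p - 1 / real n \<le> real (n div p) / real n"
       "\<forall>\<^sub>F n in sequentially. real (n div p) / real n \<le> 1 / real p"
    by (auto intro!: eventually_mono[OF eventually_gt_at_top[of 0]])
  have "(\<lambda>n. 1 / real p - 1 / real n) \<longlonglongrightarrow> 1 / real p - 0"
    by (intro tendsto_intros lim_1_over_n)
  thus "(\<lambda>n. 1 / real p - 1 / real n) \<longlonglongrightarrow> 1 / real p" by simp
qed auto

lemma filterlim_div_at_top:
  assumes "p > (0::nat)"
  shows "filterlim (\<lambda>n. n div p) at_top at_top"
  unfolding filterlim_at_top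
proof
  fix Z :: nat
  show "\<forall>\<^sub>F n in sequentially. Z \<le> n div p"
    using eventually_ge_at_top[of "Z * p"]
    by eventually_elim (use assms in \<open>simp add: less_eq_div_iff_mult_less_eq\<close>)
qed

text \<open>\<open>R'\<close> is the only limit compatible with the recursion, as it solves (1 +
  1/p) R' = (1 - 1/p) R. The deviation \<open>D\<close> from it satisfies D(n) = -q(n) D(n div p) +
  o(1) with q(n) <= 1/2, so the contraction lemma applies.\<close>

lemma liouville_average_finite:
  assumes "finite A" "\<And>p. p \<in> A \<Longrightarrow> prime p"
  shows "liouville_average A \<longlonglongrightarrow> (\<Prod>p\<in>A. (real p - 1) / (real p + 1))"
  using assms
proof (induction A rule: finite_induct)
  case empty
  have "liouville_average {} n = 1" if "n > 0" for n
    using that by (simp add: liouville_average_def liouville_in_def Omega_in_def)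
  thus ?case
    by (intro tendsto_eventually) (auto intro!: eventually_mono[OF eventually_gt_at_top[of 0]])
next
  case (insert p A)
  define R where "R = (\<Prod>p\<in>A. (real p - 1) / (real p + 1))"
  define R' where "R' = R * ((real p - 1) / (real p + 1))"
  have p: "prime p" "p \<ge> 2" using insert.prems by (auto simp: prime_ge_2_nat)
  have IH: "liouville_average A \<longlonglongrightarrow> R" using insert by (auto simp: R_def)
  define q where "q = (\<lambda>n. real (n div p) / real n)"
  have q: "q \<longlonglongrightarrow> 1 / real p" unfolding q_def using p by (intro tendsto_div_over) auto
  define D where "D = (\<lambda>n. liouville_average (insert p A) n - R')"
  define \<delta> where "\<delta> = (\<lambda>n. \<bar>liouville_average A n - q n * liouville_average A (n div p) - (1 + q n) * R'\<bar>)"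
  have rec: "liouville_average (insert p A) n + q n * liouville_average (insert p A) (n div p) =
             liouville_average A n - q n * liouville_average A (n div p)" if "n > 0" for n
  proof -
    \<comment> \<open>For n < p both sides are 0: \<open>q n\<close> vanishes, and so does the empty
      sum on the right.\<close>
    have "q n * liouville_average B (n div p) = liouville_sum B (n div p) / real n" for B
      by (cases "n div p = 0") (auto simp: q_def liouville_average_altdef liouville_sum_def)
    thus ?thesis
      using liouville_sum_remove_prime[OF p(1), of "insert p A" n] insert.hyps
      by (simp add: liouville_average_altdef add_divide_distrib[symmetric] diff_divide_distrib[symmetric])
  qed
  have "D \<longlonglongrightarrow> 0"
  proof (rule tendsto_0_div_contraction[OF p(2)])
    show "\<bar>D n\<bar> \<le> 1 + \<bar>R'\<bar>" for n
      using abs_liouville_average_le[of "insert p A" n] unfolding D_def by linarith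
    have "\<delta> \<longlonglongrightarrow> \<bar>R - 1 / real p * R - (1 + 1 / real p) * R'\<bar>"
      unfolding \<delta>_def using p
      by (intro tendsto_intros IH q filterlim_compose[OF IH filterlim_div_at_top]) auto
    also have "R - 1 / real p * R - (1 + 1 / real p) * R' = 0"
    proof -
      have "R' * (real p + 1) = R * (real p - 1)" by (simp add: R'_def add_nonneg_eq_0_iff)
      moreover have "real p * (R - 1 / real p * R - (1 + 1 / real p) * R') = R * (real p - 1) - R' * (real p + 1)"
        using p by (simp add: algebra_simps)
      ultimately show ?thesis using p by simp
    qed
    finally show "\<delta> \<longlonglongrightarrow> 0" by simp
    fix n :: nat assume n: "n > 0"
    have "D n = - q n * D (n div p) + (liouville_average A n - q n * liouville_average A (n div p) - (1 + q n) * R')"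
      using rec[OF n] by (simp add: D_def algebra_simps)
    hence "\<bar>D n\<bar> \<le> \<bar>q n * D (n div p)\<bar> + \<delta> n" unfolding \<delta>_def by linarith
    moreover have "0 \<le> q n" "q n \<le> 1 / 2"
    proof -
      have "2 * (n div p) \<le> n"
        using p by (metis mult_le_mono1 order.trans times_div_less_eq_dividend)
      hence "2 * real (n div p) \<le> real n" by linarith
      thus "0 \<le> q n" "q n \<le> 1 / 2" using n by (auto simp: q_def field_simps)
    qed
    hence "\<bar>q n * D (n div p)\<bar> \<le> 1 / 2 * \<bar>D (n div p)\<bar>"
      unfolding abs_mult by (intro mult_right_mono) auto
    ultimately show "\<bar>D n\<bar> \<le> \<bar>D (n div p)\<bar> / 2 + \<delta> n" by simp
  qed
  hence "(\<lambda>n. D n + R') \<longlonglongrightarrow> 0 + R'" by (intro tendsto_intros)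
  thus ?case using insert.hyps by (simp add: D_def R'_def R_def mult.commute)
qed

text \<open>The two functions can differ at k <= n only if k has a prime factor in A with N < p <=
  n. A union bound leaves at most n T such k, each costing at most 2. The bound is uniform in
  \<open>n\<close>, which later allows interchanging the limits in \<open>n\<close> and
  \<open>N\<close>.\<close>

lemma liouville_average_truncate:
  assumes A: "\<And>p. p \<in> A \<Longrightarrow> prime p"
    and T: "\<And>n. (\<Sum>p\<in>A \<inter> {N<..n}. 1 / real p) \<le> T"
  shows "\<bar>liouville_average A n - liouville_average (A \<inter> {..N}) n\<bar> \<le> 2 * T"
proof (cases "n = 0")
  case True
  thus ?thesis using T[of 0] by (simp add: liouville_average_def)
next
  case False
  define K where "K = (\<lambda>p. {k. k \<in> {1..n} \<and> p dvd k})"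
  define B where "B = A \<inter> {N<..n}"
  have K: "real (card (K p)) \<le> real n * (1 / real p)" if "p \<in> B" for p
  proof -
    have p: "p > 0" using that A by (auto simp: B_def prime_gt_0_nat)
    have "card (K p) = n div p"
      using sum_multiples[OF p, of "\<lambda>_. 1 :: nat" n] by (simp add: K_def)
    thus ?thesis by (simp add: of_nat_div_le_of_nat)
  qed
  have "liouville_sum A n - liouville_sum (A \<inter> {..N}) n =
        (\<Sum>k\<in>{1..n}. liouville_in A k - liouville_in (A \<inter> {..N}) k)"
    by (simp add: liouville_sum_def sum_subtractf)
  also have "\<dots> = (\<Sum>k\<in>(\<Union>p\<in>B. K p). liouville_in A k - liouville_in (A \<inter> {..N}) k)"
  proof (rule sum.mono_neutral_right; (intro ballI)?)
    fix k assume k: "k \<in> {1..n} - (\<Union>p\<in>B. K p)"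
    have "liouville_in A k = liouville_in (A \<inter> {..N}) k"
    proof (rule liouville_in_cong)
      fix p assume "prime p" "p dvd k"
      moreover from this k have "p \<le> n" by (auto dest: dvd_imp_le)
      ultimately show "p \<in> A \<longleftrightarrow> p \<in> A \<inter> {..N}" using k by (auto simp: K_def B_def)
    qed
    thus "liouville_in A k - liouville_in (A \<inter> {..N}) k = 0" by simp
  qed (auto simp: K_def)
  also have "\<bar>\<dots>\<bar> \<le> (\<Sum>k\<in>(\<Union>p\<in>B. K p). 2)"
  proof (rule order.trans[OF sum_abs sum_mono])
    show "\<bar>liouville_in A k - liouville_in (A \<inter> {..N}) k\<bar> \<le> 2" for k
      using abs_liouville_in[of A k] abs_liouville_in[of "A \<inter> {..N}" k] by linarith
  qed
  also have "\<dots> = 2 * real (card (\<Union>p\<in>B. K p))" by simp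
  also have "real (card (\<Union>p\<in>B. K p)) \<le> (\<Sum>p\<in>B. real (card (K p)))"
    using card_UN_le[of B K] by (simp add: B_def flip: of_nat_sum)
  also have "\<dots> \<le> (\<Sum>p\<in>B. real n * (1 / real p))" by (intro sum_mono K)
  also have "\<dots> \<le> real n * T"
    unfolding sum_distrib_left[symmetric] B_def by (intro mult_left_mono T) auto
  finally have "\<bar>liouville_sum A n - liouville_sum (A \<inter> {..N}) n\<bar> \<le> 2 * T * real n" by (simp add: mult_ac)
  thus ?thesis using False
    by (simp add: liouville_average_altdef diff_divide_distrib[symmetric] divide_le_eq)
qed

lemma liouville_average_tendsto_euler_product:
  assumes A: "\<And>p. p \<in> A \<Longrightarrow> prime p" and summ: "(\<lambda>p. 1 / real p) summable_on A"
  shows "\<exists>R. euler_factor_in A has_prod R \<and> liouville_average A \<longlonglongrightarrow> R"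
proof -
  define s where "s = (\<lambda>p. if p \<in> A then 1 / real p else 0)"
  have "(\<lambda>p. 1 / real p) summable_on A \<longleftrightarrow> s summable_on UNIV"
    by (rule summable_on_cong_neutral) (auto simp: s_def)
  hence "s summable_on UNIV" using summ by simp
  hence s: "summable s" using summable_on_imp_summable by blast
  have "summable (\<lambda>p. norm (euler_factor_in A p - 1))"
  proof (rule summable_comparison_test'[OF summable_mult[OF s, of 2]])
    fix p :: nat
    \<comment> \<open>For p in A the factor differs from 1 by 2/(p+1), which is below 2/p.\<close>
    show "norm (norm (euler_factor_in A p - 1)) \<le> 2 * s p"
      using A[of p] by (auto simp: euler_factor_in_def s_def divide_simps dest: prime_gt_0_nat)
  qed
  hence "convergent_prod (euler_factor_in A)"
    by (intro abs_convergent_prod_imp_convergent_prod summable_imp_abs_convergent_prod)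
  then obtain R where R: "euler_factor_in A has_prod R" using convergent_prod_has_prod by blast
  have "(\<lambda>N. \<Prod>p\<le>N. euler_factor_in A p) \<longlonglongrightarrow> R" by (rule has_prod_imp_tendsto[OF R])
  moreover have "(\<Prod>p\<le>N. euler_factor_in A p) = (\<Prod>p\<in>A \<inter> {..N}. (real p - 1) / (real p + 1))" for N
    by (rule prod.mono_neutral_cong_right) (auto simp: euler_factor_in_def)
  ultimately have RN: "(\<lambda>N. \<Prod>p\<in>A \<inter> {..N}. (real p - 1) / (real p + 1)) \<longlonglongrightarrow> R" by simp
  have "liouville_average A \<longlonglongrightarrow> R"
  proof (rule LIMSEQ_I)
    fix r :: real assume r: "r > 0"
    have "(\<lambda>N. suminf s - (\<Sum>p\<le>N. s p)) \<longlonglongrightarrow> suminf s - suminf s"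
      by (intro tendsto_intros summable_LIMSEQ'[OF s])
    hence "\<forall>\<^sub>F N in sequentially. suminf s - (\<Sum>p\<le>N. s p) < r / 8"
      using r by (intro order_tendstoD) auto
    moreover have "\<forall>\<^sub>F N in sequentially. \<bar>(\<Prod>p\<in>A \<inter> {..N}. (real p - 1) / (real p + 1)) - R\<bar> < r / 4"
      using tendstoD[OF RN, of "r / 4"] r by (simp add: dist_real_def)
    ultimately obtain N where N: "suminf s - (\<Sum>p\<le>N. s p) < r / 8"
      "\<bar>(\<Prod>p\<in>A \<inter> {..N}. (real p - 1) / (real p + 1)) - R\<bar> < r / 4"
      using eventually_happens'[OF sequentially_bot eventually_conj] by blast
    have trunc: "\<bar>liouville_average A n - liouville_average (A \<inter> {..N}) n\<bar> \<le> 2 * (r / 8)" for n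
    proof (rule liouville_average_truncate[OF A])
      fix n
      have "(\<Sum>p\<in>A \<inter> {N<..n}. 1 / real p) + (\<Sum>p\<le>N. s p) = (\<Sum>p\<in>(A \<inter> {N<..n}) \<union> {..N}. s p)"
        by (subst sum.union_disjoint) (auto simp: s_def)
      also have "\<dots> \<le> suminf s" using s by (intro sum_le_suminf) (auto simp: s_def)
      finally show "(\<Sum>p\<in>A \<inter> {N<..n}. 1 / real p) \<le> r / 8" using N(1) by linarith
    qed
    have lim: "liouville_average (A \<inter> {..N}) \<longlonglongrightarrow> (\<Prod>p\<in>A \<inter> {..N}. (real p - 1) / (real p + 1))"
      using A by (intro liouville_average_finite) auto
    have "r / 4 > 0" using r by simp
    from LIMSEQ_D[OF lim this] obtain n0 where n0: "\<And>n. n \<ge> n0 \<Longrightarrow>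
        \<bar>liouville_average (A \<inter> {..N}) n - (\<Prod>p\<in>A \<inter> {..N}. (real p - 1) / (real p + 1))\<bar> < r / 4"
      unfolding real_norm_def by blast
    have "norm (liouville_average A n - R) < r" if "n \<ge> n0" for n
      using n0[OF that] N(2) trunc[of n] r unfolding real_norm_def by linarith
    thus "\<exists>no. \<forall>n\<ge>no. norm (liouville_average A n - R) < r" by blast
  qed
  with R show ?thesis by blast
qed

subsection \<open>A dual Turan-Kubilius inequality\<close>

lemma sum_of_bool_dvd:
  assumes "d > 0"
  shows "(\<Sum>k = 1..n. of_bool (d dvd k) :: real) = real (n div d)"
proof -
  have "(\<Sum>k = 1..n. of_bool (d dvd k) :: real) = (\<Sum>k | k \<in> {1..n} \<and> d dvd k. 1)"
    by (rule sum.mono_neutral_cong_right) auto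
  also have "\<dots> = real (n div d)" by (subst sum_multiples[OF assms]) simp
  finally show ?thesis .
qed

text \<open>The functions 1 - p [p | k] have mean about 0 and are nearly orthogonal for coprime
  moduli: all terms proportional to \<open>n\<close> cancel exactly, leaving n mod p + n mod q - n
  mod (p q), bounded independently of \<open>n\<close>.\<close>

lemma multiples_discrepancy_coprime:
  assumes "p > 0" "q > 0" "coprime p q"
  shows "\<bar>\<Sum>k = 1..n. (1 - real p * of_bool (p dvd k)) * (1 - real q * of_bool (q dvd k))\<bar> \<le> real p * real q"
proof -
  have dvd: "p * q dvd k \<longleftrightarrow> p dvd k \<and> q dvd k" for k
    using assms(3) by (meson divides_mult dvd_mult_left dvd_mult_right)
  have "(\<Sum>k = 1..n. (1 - real p * of_bool (p dvd k)) * (1 - real q * of_bool (q dvd k))) =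
        (\<Sum>k = 1..n. 1 - real p * of_bool (p dvd k) - real q * of_bool (q dvd k) + real (p * q) * of_bool (p * q dvd k))"
    by (intro sum.cong refl) (auto simp: dvd algebra_simps)
  also have "\<dots> = real n - real p * real (n div p) - real q * real (n div q) + real (p * q) * real (n div (p * q))"
    using assms by (simp only: sum.distrib sum_subtractf sum_distrib_left[symmetric] sum_of_bool_dvd mult_pos_pos) simp
  also have "\<dots> = real (n mod p) + real (n mod q) - real (n mod (p * q))"
  proof -
    have "real n = real d * real (n div d) + real (n mod d)" for d
      by (metis mult_div_mod_eq of_nat_add of_nat_mult)
    from this[of p] this[of q] this[of "p * q"] show ?thesis by linarith
  qed
  also have "\<bar>\<dots>\<bar> \<le> real p * real q"
  proof -
    have "n mod p \<le> p - 1" "n mod q \<le> q - 1"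
      using assms by (auto simp: less_Suc_eq_le[symmetric])
    hence "real (n mod p) \<le> real p - 1" "real (n mod q) \<le> real q - 1"
      using assms by linarith+
    moreover have "n mod (p * q) \<le> p * q" using assms by (simp add: less_imp_le)
    hence "real (n mod (p * q)) \<le> real p * real q" by (metis of_nat_le_iff of_nat_mult)
    moreover have "(real p - 1) * (real q - 1) \<ge> 0" using assms by (intro mult_nonneg_nonneg) auto
    hence "real p + real q \<le> real p * real q + 1" by (simp add: algebra_simps)
    moreover have "real (n mod p) \<ge> 0" "real (n mod q) \<ge> 0" "real (n mod (p * q)) \<ge> 0" by auto
    ultimately show ?thesis by linarith
  qed
  finally show ?thesis .
qed

lemma multiples_discrepancy_square:
  assumes "p \<ge> 2"
  shows "(\<Sum>k = 1..n. (1 - real p * of_bool (p dvd k)) * (1 - real p * of_bool (p dvd k))) \<le> real p * real n"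
proof -
  have "(\<Sum>k = 1..n. (1 - real p * of_bool (p dvd k)) * (1 - real p * of_bool (p dvd k))) =
        (\<Sum>k = 1..n. 1 + (real p - 2) * real p * of_bool (p dvd k))"
    by (intro sum.cong refl) (auto simp: algebra_simps)
  also have "\<dots> = real n + (real p - 2) * real p * real (n div p)"
  proof -
    have "p > 0" using assms by simp
    thus ?thesis
      by (simp only: sum.distrib sum_distrib_left[symmetric] sum_of_bool_dvd) simp
  qed
  also have "\<dots> = real n + (real p - 2) * (real p * real (n div p))" by simp
  also have "\<dots> \<le> real n + (real p - 2) * real n"
  proof -
    have "p * (n div p) \<le> n" by simp
    hence "real p * real (n div p) \<le> real n" by (metis of_nat_le_iff of_nat_mult)
    thus ?thesis using assms by (intro add_left_mono mult_left_mono) auto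
  qed
  also have "\<dots> \<le> real p * real n" by (simp add: algebra_simps)
  finally show ?thesis .
qed

text \<open>
  The division is by \<open>t\<close> itself and not by its floor, so that \<open>liouville_quot A (n / p)\<close> is exactly
  \<open>p / n\<close> times a partial sum.
\<close>

definition liouville_quot :: "nat set \<Rightarrow> real \<Rightarrow> real" where
  "liouville_quot A t = liouville_sum A (nat \<lfloor>t\<rfloor>) / t"

lemma liouville_quot_divide:
  "liouville_quot A (real n / real p) = real p * liouville_sum A (n div p) / real n"
  by (simp add: liouville_quot_def floor_divide_of_nat_eq)

text \<open>n e_p is the correlation of lambda_A with c_p(k) = 1 - p [p | k]. Weighting these
  correlations by e_p/p turns n E into a correlation of lambda_A with one function W. Cauchy-Schwarz
  and the near orthogonality of the c_p give (n E)^2 <= n (2 n E), hence E <= 2.\<close>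

lemma liouville_turan_kubilius_dual:
  assumes "finite P" and P: "\<And>p. p \<in> P \<Longrightarrow> prime p \<and> p \<le> z" and z: "z * z \<le> n" and n: "n > 0"
  shows "(\<Sum>p\<in>P. (liouville_average A n - liouville_in A p * liouville_quot A (real n / real p))\<^sup>2 / real p) \<le> 2"
proof -
  define f where "f = liouville_in A"
  define e where "e = (\<lambda>p. liouville_average A n - f p * liouville_quot A (real n / real p))"
  define w where "w = (\<lambda>p. e p / real p)"
  define c where "c = (\<lambda>p k. 1 - real p * of_bool (p dvd k))"
  define W where "W = (\<lambda>k. \<Sum>p\<in>P. w p * c p k)"
  define E where "E = (\<Sum>p\<in>P. e p * w p)"
  have pos: "p > 0" if "p \<in> P" for p using P[OF that] by (simp add: prime_gt_0_nat)
  have ne: "real n * e p = (\<Sum>k = 1..n. f k * c p k)" if "p \<in> P" for p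
  proof -
    have "(\<Sum>k = 1..n. f k * of_bool (p dvd k)) = (\<Sum>k | k \<in> {1..n} \<and> p dvd k. f k)"
      by (rule sum.mono_neutral_cong_right) auto
    also have "\<dots> = (\<Sum>m = 1..n div p. f (p * m))" by (rule sum_multiples[OF pos[OF that]])
    also have "\<dots> = f p * liouville_sum A (n div p)"
      unfolding liouville_sum_def sum_distrib_left f_def
      using pos[OF that] by (intro sum.cong refl liouville_in_mult) auto
    finally have *: "(\<Sum>k = 1..n. f k * of_bool (p dvd k)) = f p * liouville_sum A (n div p)" .
    have "(\<Sum>k = 1..n. f k * c p k) = (\<Sum>k = 1..n. f k - real p * (f k * of_bool (p dvd k)))"
      by (intro sum.cong refl) (simp add: c_def algebra_simps)
    also have "\<dots> = liouville_sum A n - real p * (f p * liouville_sum A (n div p))"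
      unfolding sum_subtractf sum_distrib_left[symmetric] * by (simp add: liouville_sum_def f_def)
    finally have "(\<Sum>k = 1..n. f k * c p k) = liouville_sum A n - real p * (f p * liouville_sum A (n div p))" .
    thus ?thesis using n
      by (simp add: e_def liouville_average_altdef liouville_quot_divide right_diff_distrib)
  qed
  have E_alt: "E = (\<Sum>p\<in>P. (e p)\<^sup>2 / real p)" by (simp add: E_def w_def power2_eq_square)
  have E0: "E \<ge> 0" unfolding E_alt by (intro sum_nonneg) auto
  have "real n * E = (\<Sum>p\<in>P. w p * (\<Sum>k = 1..n. f k * c p k))"
    unfolding E_def
  proof (subst sum_distrib_left, intro sum.cong refl)
    fix p assume "p \<in> P"
    show "real n * (e p * w p) = w p * (\<Sum>k = 1..n. f k * c p k)"
      unfolding ne[OF \<open>p \<in> P\<close>, symmetric] by simp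
  qed
  also have "\<dots> = (\<Sum>k = 1..n. f k * W k)"
    unfolding W_def sum_distrib_left by (subst sum.swap) (simp add: mult_ac)
  finally have nE: "real n * E = (\<Sum>k = 1..n. f k * W k)" .
  have "(real n * E)\<^sup>2 \<le> (\<Sum>k = 1..n. (f k)\<^sup>2) * (\<Sum>k = 1..n. (W k)\<^sup>2)"
    unfolding nE by (rule Cauchy_Schwarz_ineq_sum)
  also have "(\<Sum>k = 1..n. (f k)\<^sup>2) = real n"
    by (simp add: f_def liouville_in_def power_mult[symmetric])
  also have "(\<Sum>k = 1..n. (W k)\<^sup>2) \<le> real n * E + real n * E"
  proof -
    define C where "C = (\<lambda>p q. \<Sum>k = 1..n. c p k * c q k)"
    have "(\<Sum>k = 1..n. (W k)\<^sup>2) = (\<Sum>k = 1..n. \<Sum>p\<in>P. \<Sum>q\<in>P. w p * w q * (c p k * c q k))"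
      by (simp add: W_def power2_eq_square sum_product mult_ac)
    also have "\<dots> = (\<Sum>p\<in>P. \<Sum>q\<in>P. w p * w q * C p q)"
      unfolding C_def sum_distrib_left
      by (rule trans[OF sum.swap]) (intro sum.cong[OF refl] sum.swap)
    \<comment> \<open>The diagonal terms sum to n E. Off the diagonal, the bound p q of the
      discrepancy cancels the denominators of the weights.\<close>
    also have "\<dots> \<le> (\<Sum>p\<in>P. \<Sum>q\<in>P. (if p = q then real n * (e p * w p) else 0) + \<bar>e p\<bar> * \<bar>e q\<bar>)"
    proof (intro sum_mono)
      fix p q assume pq: "p \<in> P" "q \<in> P"
      show "w p * w q * C p q \<le> (if p = q then real n * (e p * w p) else 0) + \<bar>e p\<bar> * \<bar>e q\<bar>"
      proof (cases "p = q")
        case True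
        have "p \<ge> 2" using P[OF pq(1)] by (simp add: prime_ge_2_nat)
        hence "C p p \<le> real p * real n" unfolding C_def c_def by (rule multiples_discrepancy_square)
        hence "w p * w p * C p p \<le> w p * w p * (real p * real n)" by (intro mult_left_mono) auto
        also have "\<dots> = real n * (e p * w p)" using pos[OF pq(1)] by (simp add: w_def)
        finally show ?thesis using True by (simp add: add_increasing2)
      next
        case False
        hence "coprime p q" using P pq by (simp add: primes_coprime)
        hence C: "\<bar>C p q\<bar> \<le> real p * real q"
          unfolding C_def c_def using pos pq by (intro multiples_discrepancy_coprime) auto
        have "w p * w q * C p q \<le> \<bar>w p * w q\<bar> * \<bar>C p q\<bar>" by (metis abs_ge_self abs_mult)
        also have "\<dots> \<le> \<bar>w p * w q\<bar> * (real p * real q)" by (intro mult_left_mono C) auto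
        also have "\<dots> = \<bar>e p\<bar> * \<bar>e q\<bar>" using pos pq by (simp add: w_def abs_mult)
        finally show ?thesis using False by simp
      qed
    qed
    also have "\<dots> = real n * E + (\<Sum>p\<in>P. \<bar>e p\<bar>)\<^sup>2"
    proof -
      have "(\<Sum>p\<in>P. \<bar>e p\<bar>)\<^sup>2 = (\<Sum>p\<in>P. \<Sum>q\<in>P. \<bar>e p\<bar> * \<bar>e q\<bar>)"
        by (simp only: power2_eq_square sum_product)
      thus ?thesis using assms(1) by (simp add: sum.distrib E_def sum_distrib_left)
    qed
    \<comment> \<open>Here \<open>z * z \<le> n\<close> enters: by Cauchy-Schwarz the square is at
      most E times the sum of the primes in \<open>P\<close>, of which there are at most
      \<open>z\<close>, each at most \<open>z\<close>.\<close>
    also have "(\<Sum>p\<in>P. \<bar>e p\<bar>)\<^sup>2 \<le> real n * E"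
    proof -
      have "(\<Sum>p\<in>P. \<bar>e p\<bar>)\<^sup>2 = (\<Sum>p\<in>P. sqrt (real p) * (\<bar>e p\<bar> / sqrt (real p)))\<^sup>2"
        by (intro arg_cong[of _ _ "\<lambda>x. x\<^sup>2"] sum.cong refl) (auto dest: pos)
      also have "\<dots> \<le> (\<Sum>p\<in>P. (sqrt (real p))\<^sup>2) * (\<Sum>p\<in>P. (\<bar>e p\<bar> / sqrt (real p))\<^sup>2)"
        by (rule Cauchy_Schwarz_ineq_sum)
      also have "(\<Sum>p\<in>P. (\<bar>e p\<bar> / sqrt (real p))\<^sup>2) = E"
        by (simp add: E_alt power_divide)
      also have "(\<Sum>p\<in>P. (sqrt (real p))\<^sup>2) \<le> (\<Sum>p\<in>P. real z)"
        using P by (intro sum_mono) auto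
      also have "(\<Sum>p\<in>P. real z) \<le> real z * real z"
      proof -
        have "P \<subseteq> {1..z}" using P pos by (auto simp: Suc_le_eq)
        hence "card P \<le> z" using card_mono[of "{1..z}" P] by simp
        thus ?thesis by (simp add: mult_right_mono)
      qed
      also have "real z * real z \<le> real n" using z by (metis of_nat_le_iff of_nat_mult)
      finally show ?thesis using E0 by (simp add: mult_right_mono)
    qed
    finally show ?thesis by simp
  qed
  finally have "(real n * E)\<^sup>2 \<le> real n * (real n * E + real n * E)"
    by (simp add: mult_left_mono)
  hence "(real n * real n * E) * E \<le> (real n * real n * E) * 2"
    by (simp add: power2_eq_square algebra_simps)
  moreover have "real n * real n > 0" using n by simp
  ultimately have "E \<le> 2"
    using E0 by (cases "E = 0") (auto simp: mult_le_cancel_left)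
  thus ?thesis unfolding E_alt e_def f_def .
qed

text \<open>Changing the numerator and changing the denominator each cost (t - s)/t <= ln t - ln s;
  the term 1/t pays for the floors.\<close>

lemma liouville_quot_diff_le:
  assumes "0 < s" "s \<le> t"
  shows "\<bar>liouville_quot A t - liouville_quot A s\<bar> \<le> 2 * (ln t - ln s) + 1 / t"
proof -
  define a b where "a = (t - s) / t" and "b = 1 / t"
  define S where "S = (\<lambda>t :: real. liouville_sum A (nat \<lfloor>t\<rfloor>))"
  have "\<bar>S t - S s\<bar> \<le> real (nat \<lfloor>t\<rfloor>) - real (nat \<lfloor>s\<rfloor>)"
    unfolding S_def using assms by (intro abs_liouville_sum_diff_le nat_mono floor_mono)
  also have "\<dots> \<le> t - s + 1" using assms by linarith
  finally have 1: "\<bar>(S t - S s) / t\<bar> \<le> a + b"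
    using assms by (simp add: divide_right_mono a_def b_def add_divide_distrib[symmetric])
  have "\<bar>S s\<bar> \<le> s"
    using abs_liouville_sum_le[of A "nat \<lfloor>s\<rfloor>"] assms unfolding S_def by linarith
  hence "\<bar>S s\<bar> * \<bar>1 / t - 1 / s\<bar> \<le> s * \<bar>1 / t - 1 / s\<bar>" by (intro mult_right_mono) auto
  also have "s * \<bar>1 / t - 1 / s\<bar> = (t - s) / t"
  proof -
    have "\<bar>1 / t - 1 / s\<bar> = 1 / s - 1 / t" using assms by (simp add: frac_le)
    thus ?thesis using assms by (simp add: field_simps)
  qed
  finally have 2: "\<bar>S s * (1 / t - 1 / s)\<bar> \<le> a" by (simp add: abs_mult a_def)
  have "ln s - ln t \<le> (s - t) / t" using assms by (intro ln_diff_le) auto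
  hence 3: "a \<le> ln t - ln s" by (simp add: a_def diff_divide_distrib)
  have "liouville_quot A t - liouville_quot A s = (S t - S s) / t + S s * (1 / t - 1 / s)"
    by (simp add: liouville_quot_def S_def algebra_simps diff_divide_distrib)
  moreover have "\<bar>(S t - S s) / t + S s * (1 / t - 1 / s)\<bar> \<le> (a + b) + a"
    by (rule order.trans[OF abs_triangle_ineq add_mono[OF 1 2]])
  ultimately have "\<bar>liouville_quot A t - liouville_quot A s\<bar> \<le> (a + b) + a" by simp
  also have "\<dots> \<le> 2 * (ln t - ln s) + b" using 3 by (simp add: algebra_simps)
  finally show ?thesis by (simp only: b_def)
qed

lemma liouville_quot_close:
  assumes "T > 0" "T \<le> s" "T \<le> t" "\<bar>ln t - ln s\<bar> \<le> d"
  shows "\<bar>liouville_quot A t - liouville_quot A s\<bar> \<le> 2 * d + 1 / T"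
proof -
  have "1 / t \<le> 1 / T" "1 / s \<le> 1 / T" using assms by (auto intro!: divide_left_mono)
  thus ?thesis
    using liouville_quot_diff_le[of s t A] liouville_quot_diff_le[of t s A] assms
    by (cases "s \<le> t") auto
qed

lemma liouville_average_step:
  assumes "n > 0"
  shows "\<bar>liouville_average A (Suc n) - liouville_average A n\<bar> \<le> 2 / real n"
proof -
  have "\<bar>liouville_average A n\<bar> \<le> 1" by (rule abs_liouville_average_le)
  moreover have "liouville_average A (Suc n) - liouville_average A n =
     (liouville_in A (Suc n) - liouville_average A n) / real (Suc n)"
    using assms by (simp add: liouville_average_altdef liouville_sum_def field_simps)
  moreover have "\<bar>liouville_in A (Suc n)\<bar> = 1" by simp
  moreover from calculation have "\<bar>liouville_in A (Suc n) - liouville_average A n\<bar> \<le> 2"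
    by linarith
  ultimately have "\<bar>liouville_average A (Suc n) - liouville_average A n\<bar> \<le> 2 / real (Suc n)"
    by (simp add: divide_right_mono abs_divide del: of_nat_Suc abs_liouville_in)
  also have "\<dots> \<le> 2 / real n" using assms by (intro divide_left_mono) auto
  finally show ?thesis .
qed

subsection \<open>Slow variation of the absolute mean value\<close>

text \<open>Stacks \<open>J\<close> adjacent windows, so that the prime weight can outgrow the fixed
  total that the Turan-Kubilius bound allows to bad primes.\<close>

lemma sum_inverse_primes_lower_power:
  assumes "a \<ge> 20"
  shows "(\<Sum>p | prime p \<and> exp a < real p \<and> real p \<le> exp (8 ^ J * a). 1 / real p) \<ge> real J / 4"
proof (induction J)
  case (Suc J)
  define b where "b = 8 ^ J * a"
  have "1 * a \<le> 8 ^ J * a" using assms by (intro mult_right_mono) auto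
  hence "a \<le> b" by (simp add: b_def)
  hence b: "a \<le> b" "b \<ge> 20" using assms by linarith+
  have fin: "finite {p :: nat. prime p \<and> c < real p \<and> real p \<le> d}" for c d :: real
    using finite_primes_le[of "\<lambda>p. prime p \<and> c < real p" d] by (simp add: conj_assoc)
  have "{p. prime p \<and> exp a < real p \<and> real p \<le> exp (8 * b)} =
        {p. prime p \<and> exp a < real p \<and> real p \<le> exp b} \<union> {p. prime p \<and> exp b < real p \<and> real p \<le> exp (8 * b)}"
  proof (rule Set.set_eqI)
    fix p :: nat
    have "exp a \<le> exp b" "exp b \<le> exp (8 * b)" using b by auto
    thus "p \<in> {p. prime p \<and> exp a < real p \<and> real p \<le> exp (8 * b)} \<longleftrightarrow>
      p \<in> {p. prime p \<and> exp a < real p \<and> real p \<le> exp b} \<union> {p. prime p \<and> exp b < real p \<and> real p \<le> exp (8 * b)}"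
      by (simp del: exp_le_cancel_iff) linarith
  qed
  hence "(\<Sum>p | prime p \<and> exp a < real p \<and> real p \<le> exp (8 * b). 1 / real p) =
        (\<Sum>p | prime p \<and> exp a < real p \<and> real p \<le> exp b. 1 / real p) +
        (\<Sum>p | prime p \<and> exp b < real p \<and> real p \<le> exp (8 * b). 1 / real p)"
    using fin by (simp only:) (rule sum.union_disjoint; auto)
  also have "\<dots> \<ge> real J / 4 + 1 / 4"
    using Suc.IH sum_inverse_primes_lower[OF b(2)] unfolding b_def by (intro add_mono) auto
  finally show ?case by (simp add: b_def mult.assoc add_divide_distrib)
qed (simp add: sum_nonneg)

lemma sum_inverse_atLeastLessThan_le:
  assumes "0 < a" "a \<le> b"
  shows "(\<Sum>k\<in>{a..<b}. 1 / real k) \<le> 2 * (ln (real b) - ln (real a))"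
  using assms(2)
proof (induction b rule: dec_induct)
  case (step k)
  have k: "k > 0" using step assms by simp
  have "ln (real k) - ln (real (Suc k)) \<le> (real k - real (Suc k)) / real (Suc k)"
    using k by (intro ln_diff_le) auto
  hence "1 / real (Suc k) \<le> ln (real (Suc k)) - ln (real k)" by simp
  moreover have "1 / real k \<le> 2 * (1 / real (Suc k))" using k by (simp add: field_simps)
  ultimately show ?case using step by simp
qed auto

lemma ln_le_of_le_exp: "0 < x \<Longrightarrow> x \<le> exp y \<Longrightarrow> ln x \<le> (y :: real)"
  using ln_le_cancel_iff[of x "exp y"] by simp

lemma liouville_average_two_close:
  assumes "0 < \<rho>" "\<rho> \<le> 1"
  shows "\<exists>\<eta>>0. \<exists>X. \<forall>n\<ge>X. \<forall>y :: nat \<Rightarrow> nat.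
    (\<forall>i<300. n \<le> y i \<and> ln (real (y i)) \<le> (1 + \<eta>) * ln (real n)) \<longrightarrow>
    (\<exists>i j. i < j \<and> j < 300 \<and>
      \<bar>\<bar>liouville_average A (y i)\<bar> - \<bar>liouville_average A (y j)\<bar>\<bar> \<le> 4 * \<rho>)"
proof -
  \<comment> \<open>Two matched quotients will be within 2 \<epsilon> logarithmically, hence differ
    by at most 4 \<epsilon> + \<rho> = 2 \<rho>. The two Turan-Kubilius errors of size \<rho>
    complete the 4 \<rho>.\<close>
  define \<epsilon> where "\<epsilon> = \<rho> / 4"
  \<comment> \<open>Primes with error above \<rho> have weight at most 2/\<rho>^2 <= J/8, half of
    the guaranteed J/4.\<close>
  define J where "J = nat \<lceil>16 / \<rho>\<^sup>2\<rceil> + 1"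
  define D :: nat where "D = 8 ^ J"
  have \<epsilon>: "0 < \<epsilon>" "\<epsilon> \<le> 1" using assms by (auto simp: \<epsilon>_def)
  have D: "D \<ge> 1" by (simp add: D_def)
  have J: "J \<ge> 1" "16 / \<rho>\<^sup>2 \<le> real J" unfolding J_def by (simp, linarith)
  obtain K where K: "K > 0" "\<And>k. k \<ge> K \<Longrightarrow> (\<Sum>p | prime p \<and> exp (\<epsilon> * real k) < real p \<and>
      real p \<le> exp (\<epsilon> * real (Suc k)). 1 / real p) \<le> 5 / real k"
    using brun_titchmarsh_log_bins[OF \<epsilon>] by blast
  \<comment> \<open>This keeps every shift \<open>s i\<close> at most \<open>K1\<close>, while the
    primes used start at bin \<open>2 * K1\<close>; shifted bin indices therefore stay at or above
    \<open>K1\<close>.\<close>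
  define \<eta> where "\<eta> = 1 / (16 * real D)"
  \<comment> \<open>Forces K1 >= K and \<epsilon> K1 >= 20 + 1/\<rho>: the bin bound applies, the
    prime windows start far enough out, and the rounding term exp(-\<epsilon> K1) is at most
    \<rho>.\<close>
  define L0 where "L0 = 16 * \<epsilon> * real D * (real K + (20 + 1 / \<rho>) / \<epsilon> + 1)"
  define X where "X = nat \<lceil>exp L0\<rceil>"
  have "\<exists>i j. i < j \<and> j < 300 \<and>
      \<bar>\<bar>liouville_average A (y i)\<bar> - \<bar>liouville_average A (y j)\<bar>\<bar> \<le> 4 * \<rho>"
    if n: "n \<ge> X" and y: "\<And>i. i < 300 \<Longrightarrow> n \<le> y i \<and> ln (real (y i)) \<le> (1 + \<eta>) * ln (real n)"
    for n and y :: "nat \<Rightarrow> nat"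
  proof (rule ccontr)
    assume *: "\<not> ?thesis"
    have sep: "\<bar>\<bar>liouville_average A (y i)\<bar> - \<bar>liouville_average A (y j)\<bar>\<bar> > 4 * \<rho>"
      if "i < 300" "j < 300" "i \<noteq> j" for i j
    proof (cases "i < j")
      case True
      thus ?thesis using * that by (auto simp: not_le)
    next
      case False
      hence "j < i" using that by simp
      hence "\<bar>\<bar>liouville_average A (y j)\<bar> - \<bar>liouville_average A (y i)\<bar>\<bar> > 4 * \<rho>"
        using * that by (auto simp: not_le)
      thus ?thesis by (subst abs_minus_commute)
    qed
    define L where "L = ln (real n)"
    \<comment> \<open>The scale is set so that the largest primes used, up to exp(\<epsilon> K2),
      are at most n^(1/4), small enough for the Turan-Kubilius inequality and for y/p to remain
      large.\<close>
    define K1 where "K1 = nat \<lfloor>L / (8 * \<epsilon> * real D)\<rfloor>"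
    define K2 where "K2 = 2 * D * K1"
    define s where "s = (\<lambda>i. nat \<lfloor>(ln (real (y i)) - L) / \<epsilon>\<rfloor>)"
    define B where "B = (\<lambda>k::nat. {p :: nat. prime p \<and> exp (\<epsilon> * real k) < real p \<and> real p \<le> exp (\<epsilon> * real (Suc k))})"
    define R where "R = {p :: nat. prime p \<and> exp (2 * \<epsilon> * real K1) < real p \<and> real p \<le> exp (\<epsilon> * real K2)}"
    define e where "e = (\<lambda>i p. liouville_average A (y i) - liouville_in A p * liouville_quot A (real (y i) / real p))"
    define G where "G = (\<lambda>i. {p \<in> R. \<bar>e i p\<bar> \<le> \<rho>})"
    \<comment> \<open>Bins are open on the left and closed on the right, hence ceiling minus 1 and
      not floor.\<close>
    define b where "b = (\<lambda>p::nat. nat (\<lceil>ln (real p) / \<epsilon>\<rceil> - 1))"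
    define v where "v = (\<lambda>S :: nat set. \<Sum>p\<in>S. 1 / real p)"

    have "exp L0 \<le> real X" unfolding X_def by linarith
    hence expL0: "exp L0 \<le> real n" using n by linarith
    have n0: "n > 0" using expL0 exp_gt_zero[of L0] by (intro Nat.gr0I) auto
    have L: "L0 \<le> L" unfolding L_def using expL0 n0 by (simp add: ln_ge_iff)
    have pos: "8 * \<epsilon> * real D > 0" using \<epsilon> D by simp
    define w where "w = L / (8 * \<epsilon> * real D)"
    define q where "q = (20 + 1 / \<rho>) / \<epsilon>"
    have "16 * \<epsilon> * real D * (real K + q + 1) \<le> L" using L by (simp add: L0_def q_def)
    hence L': "2 * (real K + q + 1) \<le> w"
      using pos by (simp add: w_def pos_le_divide_eq mult_ac)
    have q0: "q \<ge> 0" using assms \<epsilon> by (simp add: q_def)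
    hence w0: "w \<ge> 2" using L' by simp
    have K1_le: "real K1 \<le> w" and K1_ge: "w - 1 \<le> real K1"
      using w0 unfolding K1_def w_def[symmetric] by linarith+
    have K1_K: "real K + q \<le> real K1" using L' q0 K1_ge by simp
    hence "K \<le> K1" using q0 by simp
    hence K1pos: "K1 > 0" using K(1) by simp
    have "q \<le> real K1" using K1_K by simp
    hence eK1: "20 + 1 / \<rho> \<le> \<epsilon> * real K1" using \<epsilon> by (simp add: q_def pos_divide_le_eq mult.commute)
    have "1 / \<rho> > 0" using assms by simp
    hence eK1': "20 \<le> \<epsilon> * real K1" "1 / \<rho> \<le> \<epsilon> * real K1" using eK1 by linarith+
    have "w / 2 \<le> real K1" using K1_ge w0 by simp
    moreover have "\<eta> * L / \<epsilon> = w / 2" by (simp add: \<eta>_def w_def)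
    ultimately have etaL: "\<eta> * L / \<epsilon> \<le> real K1" by (simp only:)
    have eK2: "4 * (\<epsilon> * real K2) \<le> L"
      using K1_le pos by (simp add: K2_def w_def pos_le_divide_eq mult_ac)
    have K12: "2 * K1 \<le> K2" using D by (simp add: K2_def)

    have s_le: "s i \<le> K1" if "i < 300" for i
    proof -
      have "ln (real (y i)) - L \<le> \<eta> * L" using y[OF that] by (simp add: L_def algebra_simps)
      hence "(ln (real (y i)) - L) / \<epsilon> \<le> \<eta> * L / \<epsilon>" using \<epsilon> by (intro divide_right_mono) auto
      also note etaL
      finally show ?thesis unfolding s_def by linarith
    qed
    have s_bounds: "\<epsilon> * real (s i) \<le> ln (real (y i)) - L \<and> ln (real (y i)) - L \<le> \<epsilon> * real (s i) + \<epsilon>"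
      if "i < 300" for i
    proof -
      have "L \<le> ln (real (y i))" using y[OF that] n0 by (simp add: L_def)
      hence "(ln (real (y i)) - L) / \<epsilon> \<ge> 0" using \<epsilon> by simp
      hence "real (s i) \<le> (ln (real (y i)) - L) / \<epsilon>" "(ln (real (y i)) - L) / \<epsilon> \<le> real (s i) + 1"
        unfolding s_def by linarith+
      thus ?thesis using \<epsilon> by (simp add: pos_le_divide_eq pos_divide_le_eq algebra_simps)
    qed
    have finR: "finite R"
      using finite_primes_le[of "\<lambda>p. prime p \<and> exp (2 * \<epsilon> * real K1) < real p" "exp (\<epsilon> * real K2)"]
      by (simp add: R_def conj_assoc)
    have finB: "finite (B k)" for k
      using finite_primes_le[of "\<lambda>p. prime p \<and> exp (\<epsilon> * real k) < real p" "exp (\<epsilon> * real (Suc k))"]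
      by (simp add: B_def conj_assoc)
    have finG: "finite (G i)" for i using finR by (simp add: G_def)

    have vR: "v R \<ge> real J / 4"
      using sum_inverse_primes_lower_power[of "2 * \<epsilon> * real K1" J] eK1'
      by (simp add: v_def R_def K2_def D_def mult_ac)
    have vG: "v (G i) \<ge> real J / 8" if i: "i < 300" for i
    proof -
      define z where "z = nat \<lfloor>exp (\<epsilon> * real K2)\<rfloor>"
      have "real z \<le> exp (\<epsilon> * real K2)" unfolding z_def by simp
      hence "real z * real z \<le> exp (\<epsilon> * real K2) * exp (\<epsilon> * real K2)" by (intro mult_mono) auto
      also have "\<dots> = exp (2 * (\<epsilon> * real K2))" by (simp add: exp_add[symmetric])
      also have "\<dots> \<le> exp L"
      proof -
        have "0 \<le> \<epsilon> * real K2" using \<epsilon> by simp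
        hence "2 * (\<epsilon> * real K2) \<le> L" using eK2 by linarith
        thus ?thesis by simp
      qed
      also have "\<dots> = real n" using n0 by (simp add: L_def)
      finally have "z * z \<le> n" by (metis of_nat_le_iff of_nat_mult)
      hence z: "z * z \<le> y i" "y i > 0" using y[OF i] n0 by auto
      have "(\<Sum>p\<in>R. (e i p)\<^sup>2 / real p) \<le> 2"
        unfolding e_def
        by (rule liouville_turan_kubilius_dual[OF finR _ z]) (auto simp: R_def z_def le_nat_floor)
      moreover have "(\<Sum>p\<in>R - G i. \<rho>\<^sup>2 * (1 / real p)) \<le> (\<Sum>p\<in>R. (e i p)\<^sup>2 / real p)"
      proof (rule order.trans[OF sum_mono sum_mono2])
        fix p assume "p \<in> R - G i"
        hence "\<rho> \<le> \<bar>e i p\<bar>" by (auto simp: G_def)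
        hence "\<rho>\<^sup>2 \<le> (e i p)\<^sup>2" using assms by (metis abs_le_square_iff abs_of_pos)
        thus "\<rho>\<^sup>2 * (1 / real p) \<le> (e i p)\<^sup>2 / real p" by (simp add: divide_right_mono)
      qed (use finR in auto)
      ultimately have "\<rho>\<^sup>2 * v (R - G i) \<le> 2" by (simp add: v_def sum_distrib_left)
      hence "v (R - G i) \<le> 2 / \<rho>\<^sup>2" using assms by (simp add: pos_le_divide_eq mult.commute)
      also have "\<dots> \<le> real J / 8" using J(2) by simp
      finally have "v (R - G i) \<le> real J / 8" .
      moreover have "v (R - G i) = v R - v (G i)"
        unfolding v_def using finR by (intro sum_diff) (auto simp: G_def)
      ultimately show ?thesis using vR by linarith
    qed

    have bR: "b p \<in> {2 * K1..<K2}" and bB: "p \<in> B (b p)" if "p \<in> R" for p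
    proof -
      have p: "prime p" "exp (2 * \<epsilon> * real K1) < real p" "real p \<le> exp (\<epsilon> * real K2)"
        using that by (auto simp: R_def)
      hence p0: "real p > 0" by (simp add: prime_gt_0_nat)
      have "2 * \<epsilon> * real K1 < ln (real p)" "ln (real p) \<le> \<epsilon> * real K2"
        using p p0 by (metis exp_less_cancel_iff exp_ln, metis exp_le_cancel_iff exp_ln)
      hence 1: "real (2 * K1) < ln (real p) / \<epsilon>" "ln (real p) / \<epsilon> \<le> real K2"
        using \<epsilon> by (auto simp: pos_less_divide_eq pos_divide_le_eq mult_ac)
      hence 2: "real (b p) < ln (real p) / \<epsilon>" "ln (real p) / \<epsilon> \<le> real (b p) + 1"
        unfolding b_def by linarith+
      show "b p \<in> {2 * K1..<K2}" using 1 unfolding b_def by (simp; linarith)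
      have "\<epsilon> * real (b p) < ln (real p)" "ln (real p) \<le> \<epsilon> * real (Suc (b p))"
        using 2 \<epsilon> by (auto simp: pos_less_divide_eq pos_divide_le_eq mult.commute[of \<epsilon>] add.commute)
      hence "exp (\<epsilon> * real (b p)) < real p" "real p \<le> exp (\<epsilon> * real (Suc (b p)))"
        using p0 by (metis exp_less_cancel_iff exp_ln, metis exp_le_cancel_iff exp_ln)
      thus "p \<in> B (b p)" using p by (simp add: B_def)
    qed

    \<comment> \<open>Good primes of y_i, indexed by bin relative to the position of y_i, so that
      ln(y_i/p) is L - \<epsilon> k up to \<epsilon> whatever \<open>i\<close> is. The subtraction
      does not truncate, as b p >= 2 K1 and s i <= K1.\<close>
    define H where "H = (\<lambda>i k. {p \<in> G i. b p - s i = k})"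
    have H_sub: "H i k \<subseteq> B (k + s i)" if "i < 300" for i k
    proof
      fix p assume p: "p \<in> H i k"
      hence "p \<in> R" by (auto simp: H_def G_def)
      hence "b p \<ge> s i" using bR s_le[OF that] by fastforce
      hence "b p = k + s i" using p by (auto simp: H_def)
      thus "p \<in> B (k + s i)" using bB[OF \<open>p \<in> R\<close>] by simp
    qed
    have vG_H: "v (G i) = (\<Sum>k\<in>{K1..<K2}. v (H i k))" if "i < 300" for i
      unfolding v_def H_def
    proof (rule sum.group[symmetric, OF finG])
      show "(\<lambda>p. b p - s i) ` G i \<subseteq> {K1..<K2}"
        using bR s_le[OF that] by (fastforce simp: G_def)
    qed auto

    have disj: "H i k = {} \<or> H j k = {}" if ij: "i < 300" "j < 300" "i \<noteq> j" for i j k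
    proof (rule ccontr)
      assume "\<not> ?thesis"
      then obtain p q where pq: "p \<in> H i k" "q \<in> H j k" by auto
      have lnb: "\<epsilon> * (real k + real (s i')) \<le> ln (real p') \<and> ln (real p') \<le> \<epsilon> * (real k + real (s i')) + \<epsilon> \<and>
            exp (\<epsilon> * real K1) \<le> real (y i') / real p' \<and> p' > 0 \<and> \<bar>e i' p'\<bar> \<le> \<rho>"
        if "i' < 300" "p' \<in> H i' k" for i' p'
      proof -
        have "p' \<in> B (k + s i')" using H_sub that by blast
        hence p: "prime p'" "exp (\<epsilon> * (real k + real (s i'))) < real p'" "real p' \<le> exp (\<epsilon> * (real k + real (s i')) + \<epsilon>)"
          by (auto simp: B_def algebra_simps)
        hence p0: "p' > 0" by (simp add: prime_gt_0_nat)
        have 1: "\<epsilon> * (real k + real (s i')) \<le> ln (real p')" "ln (real p') \<le> \<epsilon> * (real k + real (s i')) + \<epsilon>"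
          using p p0 by (auto simp: ln_ge_iff less_imp_le intro!: ln_le_of_le_exp)
        have "real p' \<le> exp (\<epsilon> * real K2)" using that(2) by (auto simp: H_def G_def R_def)
        hence "exp (\<epsilon> * real K1) * real p' \<le> exp (\<epsilon> * real K1) * exp (\<epsilon> * real K2)" by simp
        also have "\<dots> = exp (\<epsilon> * real K1 + \<epsilon> * real K2)" by (simp add: exp_add)
        also have "\<dots> \<le> exp L"
        proof -
          have "\<epsilon> * real K1 \<le> \<epsilon> * real K2" using K12 \<epsilon> by (intro mult_left_mono) auto
          moreover have "0 \<le> \<epsilon> * real K2" using \<epsilon> by simp
          ultimately have "\<epsilon> * real K1 + \<epsilon> * real K2 \<le> L" using eK2 by linarith
          thus ?thesis by simp
        qed
        also have "\<dots> = real n" using n0 by (simp add: L_def)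
        also have "\<dots> \<le> real (y i')" using y[OF that(1)] by simp
        finally have "exp (\<epsilon> * real K1) \<le> real (y i') / real p'" using p0 by (simp add: pos_le_divide_eq)
        thus ?thesis using 1 p0 that(2) by (auto simp: H_def G_def)
      qed
      note P = lnb[OF ij(1) pq(1)] and Q = lnb[OF ij(2) pq(2)]
      have y0: "y i > 0" "y j > 0" using y[of i] y[of j] ij n0 by auto
      have "\<bar>ln (real (y i) / real p) - ln (real (y j) / real q)\<bar> \<le> 2 * \<epsilon>"
      proof -
        have "ln (real (y i) / real p) = ln (real (y i)) - ln (real p)"
             "ln (real (y j) / real q) = ln (real (y j)) - ln (real q)"
          using P Q y0 by (auto simp: ln_div)
        moreover have "\<epsilon> * (real k + real (s i)) = \<epsilon> * real k + \<epsilon> * real (s i)"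
          "\<epsilon> * (real k + real (s j)) = \<epsilon> * real k + \<epsilon> * real (s j)" by (simp_all add: algebra_simps)
        ultimately show ?thesis
          using P Q s_bounds[OF ij(1)] s_bounds[OF ij(2)] by linarith
      qed
      hence "\<bar>liouville_quot A (real (y i) / real p) - liouville_quot A (real (y j) / real q)\<bar>
              \<le> 2 * (2 * \<epsilon>) + 1 / exp (\<epsilon> * real K1)"
        using P Q by (intro liouville_quot_close) auto
      also have "1 / exp (\<epsilon> * real K1) \<le> \<rho>"
      proof -
        have "1 / \<rho> \<le> exp (\<epsilon> * real K1)"
          using eK1'(2) exp_ge_add_one_self[of "\<epsilon> * real K1"] by linarith
        thus ?thesis using assms by (simp add: field_simps)
      qed
      finally have close: "\<bar>liouville_quot A (real (y i) / real p) - liouville_quot A (real (y j) / real q)\<bar> \<le> 2 * \<rho>"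
        by (simp add: \<epsilon>_def)
      \<comment> \<open>The factor lambda_A(p) is a sign, so it disappears on passing to absolute
        values.\<close>
      have tri: "\<bar>\<bar>liouville_average A (y i')\<bar> - \<bar>liouville_quot A (real (y i') / real p')\<bar>\<bar> \<le> \<bar>e i' p'\<bar>" for i' p'
        using abs_triangle_ineq3[of "liouville_average A (y i')" "liouville_in A p' * liouville_quot A (real (y i') / real p')"]
        by (simp add: e_def abs_mult)
      have "\<bar>\<bar>liouville_average A (y i)\<bar> - \<bar>liouville_average A (y j)\<bar>\<bar> \<le> 4 * \<rho>"
      proof -
        have chain: "\<bar>a - b\<bar> \<le> 4 * \<rho>" if "\<bar>a - c\<bar> \<le> \<rho>" "\<bar>b - d\<bar> \<le> \<rho>" "\<bar>c - d\<bar> \<le> 2 * \<rho>" for a b c d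
          using that by linarith
        show ?thesis
        proof (rule chain)
          show "\<bar>\<bar>liouville_average A (y i)\<bar> - \<bar>liouville_quot A (real (y i) / real p)\<bar>\<bar> \<le> \<rho>"
            using P by (intro order.trans[OF tri]) auto
          show "\<bar>\<bar>liouville_average A (y j)\<bar> - \<bar>liouville_quot A (real (y j) / real q)\<bar>\<bar> \<le> \<rho>"
            using Q by (intro order.trans[OF tri]) auto
          show "\<bar>\<bar>liouville_quot A (real (y i) / real p)\<bar> - \<bar>liouville_quot A (real (y j) / real q)\<bar>\<bar> \<le> 2 * \<rho>"
            by (rule order.trans[OF abs_triangle_ineq3 close])
        qed
      qed
      thus False using sep[OF ij] by linarith
    qed
    \<comment> \<open>By \<open>disj\<close> at most one \<open>i\<close> contributes for each
      \<open>k\<close>, so a single bin bound pays for all 300 points.\<close>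
    have vH: "(\<Sum>i<300. v (H i k)) \<le> 5 / real k" if k: "k \<in> {K1..<K2}" for k
    proof (cases "\<exists>i<300. H i k \<noteq> {}")
      case True
      then obtain i where i: "i < 300" "H i k \<noteq> {}" by blast
      have "(\<Sum>j<300. v (H j k)) = (\<Sum>j\<in>{i}. v (H j k))"
        using disj[of i _ k] i by (intro sum.mono_neutral_right) (auto simp: v_def)
      also have "\<dots> = v (H i k)" by simp
      also have "\<dots> \<le> v (B (k + s i))"
        unfolding v_def using finB H_sub[OF i(1)] by (intro sum_mono2) auto
      also have "\<dots> \<le> 5 / real (k + s i)"
        unfolding v_def B_def using \<open>K \<le> K1\<close> k by (intro K(2)) auto
      also have "\<dots> \<le> 5 / real k" using k K1pos by (intro divide_left_mono) auto
      finally show ?thesis .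
    qed (auto simp: v_def)
    have "300 * (real J / 8) \<le> (\<Sum>i<300. v (G i))"
      using sum_mono[of "{..<300::nat}" "\<lambda>_. real J / 8" "\<lambda>i. v (G i)"] vG by simp
    also have "\<dots> = (\<Sum>i<300. \<Sum>k\<in>{K1..<K2}. v (H i k))" by (intro sum.cong refl vG_H) auto
    also have "\<dots> = (\<Sum>k\<in>{K1..<K2}. \<Sum>i<300. v (H i k))" by (rule sum.swap)
    also have "\<dots> \<le> (\<Sum>k\<in>{K1..<K2}. 5 / real k)" by (intro sum_mono vH)
    also have "\<dots> = 5 * (\<Sum>k\<in>{K1..<K2}. 1 / real k)" by (simp add: sum_distrib_left)
    also have "\<dots> \<le> 5 * (2 * (ln (real K2) - ln (real K1)))"
      using K1pos K12 by (intro mult_left_mono sum_inverse_atLeastLessThan_le) auto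
    also have "ln (real K2) - ln (real K1) = ln 2 + real J * ln 8"
      using K1pos D by (simp add: K2_def D_def ln_mult ln_realpow)
    also have "ln (8::real) = 3 * ln 2" using ln_realpow[of "2::real" 3] by simp
    also have "5 * (2 * (ln 2 + real J * (3 * ln 2))) \<le> 5 * (2 * (1 * 25/36 + real J * (3 * (25/36))))"
      using ln2_le_25_over_36 by (intro mult_left_mono add_mono) auto
    also have "\<dots> \<le> 30 * real J" using J(1) by simp
    finally show False using J(1) by simp
  qed
  moreover have "\<eta> > 0" using D by (simp add: \<eta>_def)
  ultimately show ?thesis by blast
qed

lemma discrete_intermediate_value:
  fixes g :: "nat \<Rightarrow> real"
  assumes "n \<le> m" "g n \<le> c" "c \<le> g m" "0 \<le> \<delta>"
    and "\<And>k. n \<le> k \<Longrightarrow> k < m \<Longrightarrow> \<bar>g (Suc k) - g k\<bar> \<le> \<delta>"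
  shows "\<exists>k. n \<le> k \<and> k \<le> m \<and> \<bar>g k - c\<bar> \<le> \<delta>"
  using assms
proof (induction m rule: dec_induct)
  case base
  thus ?case by (intro exI[of _ n]) auto
next
  case (step m)
  show ?case
  proof (cases "c \<le> g m")
    case True
    with step obtain k where "n \<le> k" "k \<le> m" "\<bar>g k - c\<bar> \<le> \<delta>" by auto
    thus ?thesis by (intro exI[of _ k]) auto
  next
    case False
    have "\<bar>g (Suc m) - g m\<bar> \<le> \<delta>" using step by auto
    thus ?thesis using False step by (intro exI[of _ "Suc m"]) auto
  qed
qed

lemma discrete_intermediate_value':
  fixes g :: "nat \<Rightarrow> real"
  assumes nm: "n \<le> m" and c: "c \<in> closed_segment (g n) (g m)" and "0 \<le> \<delta>"
    and step: "\<And>k. n \<le> k \<Longrightarrow> k < m \<Longrightarrow> \<bar>g (Suc k) - g k\<bar> \<le> \<delta>"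
  shows "\<exists>k. n \<le> k \<and> k \<le> m \<and> \<bar>g k - c\<bar> \<le> \<delta>"
proof (cases "g n \<le> g m")
  case True
  hence "g n \<le> c" "c \<le> g m" using c by (auto simp: closed_segment_eq_real_ivl)
  thus ?thesis using assms by (intro discrete_intermediate_value) auto
next
  case False
  hence c': "- g n \<le> - c" "- c \<le> - g m" using c by (auto simp: closed_segment_eq_real_ivl)
  have "\<exists>k. n \<le> k \<and> k \<le> m \<and> \<bar>- g k - (- c)\<bar> \<le> \<delta>"
  proof (rule discrete_intermediate_value[OF nm c' assms(3)])
    show "\<bar>- g (Suc k) - - g k\<bar> \<le> \<delta>" if "n \<le> k" "k < m" for k
      using step[OF that] by linarith
  qed
  moreover have "\<bar>- g k - (- c)\<bar> = \<bar>g k - c\<bar>" for k by linarith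
  ultimately show ?thesis by simp
qed

text \<open>A change d with abs d > r would, by the small steps of the average, pass near 300 values
  spaced abs d/300 apart. The points reached would be pairwise separated, against
  \<open>liouville_average_two_close\<close>.\<close>

lemma abs_liouville_average_slowly_varying:
  assumes "r > 0"
  shows "\<exists>\<eta>>0. \<exists>X. \<forall>n\<ge>X. \<forall>m\<ge>n. ln (real m) \<le> (1 + \<eta>) * ln (real n) \<longrightarrow>
    \<bar>\<bar>liouville_average A m\<bar> - \<bar>liouville_average A n\<bar>\<bar> \<le> r"
proof -
  \<comment> \<open>The closeness 4 \<rho> <= r/600 plus two approximation errors, each below
    r/1200, stays below the spacing r/300.\<close>
  define \<rho> where "\<rho> = min 1 (r / 2400)"
  have \<rho>: "0 < \<rho>" "\<rho> \<le> 1" "4 * \<rho> \<le> r / 600" using assms by (auto simp: \<rho>_def)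
  obtain \<eta> X where \<eta>: "\<eta> > 0" and X: "\<forall>n\<ge>X. \<forall>y :: nat \<Rightarrow> nat.
      (\<forall>i<300. n \<le> y i \<and> ln (real (y i)) \<le> (1 + \<eta>) * ln (real n)) \<longrightarrow>
      (\<exists>i j. i < j \<and> j < 300 \<and> \<bar>\<bar>liouville_average A (y i)\<bar> - \<bar>liouville_average A (y j)\<bar>\<bar> \<le> 4 * \<rho>)"
    using liouville_average_two_close[OF \<rho>(1,2), of A] by blast
  define Y where "Y = max (max X 1) (nat \<lceil>2400 / r\<rceil> + 1)"
  have "\<bar>\<bar>liouville_average A m\<bar> - \<bar>liouville_average A n\<bar>\<bar> \<le> r"
    if n: "n \<ge> Y" and m: "m \<ge> n" "ln (real m) \<le> (1 + \<eta>) * ln (real n)" for n m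
  proof (rule ccontr)
    define g where "g = (\<lambda>n. \<bar>liouville_average A n\<bar>)"
    define d where "d = g m - g n"
    assume "\<not> ?thesis"
    hence d: "\<bar>d\<bar> > r" by (simp add: d_def g_def)
    have nX: "n \<ge> X" "n > 0" using n by (auto simp: Y_def)
    have "2400 / r < real Y" unfolding Y_def by linarith
    hence "2400 / r < real n" using n by linarith
    hence n1: "2 / real n < r / 1200" using assms nX by (simp add: field_simps)
    have "\<exists>k. n \<le> k \<and> k \<le> m \<and> \<bar>g k - (g n + real i / 300 * d)\<bar> \<le> 2 / real n" if "i < 300" for i :: nat
    proof (rule discrete_intermediate_value')
      show "g n + real i / 300 * d \<in> closed_segment (g n) (g m)"
      proof -
        define u where "u = real i / 300"
        have "0 \<le> u" "u \<le> 1" using that by (auto simp: u_def)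
        moreover have "g n + u * d = (1 - u) * g n + u * g m" by (simp add: d_def algebra_simps)
        ultimately show ?thesis unfolding in_segment u_def[symmetric] by auto
      qed
      fix k assume k: "n \<le> k"
      have "\<bar>g (Suc k) - g k\<bar> \<le> \<bar>liouville_average A (Suc k) - liouville_average A k\<bar>"
        unfolding g_def by (rule abs_triangle_ineq3)
      also have "\<dots> \<le> 2 / real k" using k nX by (intro liouville_average_step) auto
      also have "\<dots> \<le> 2 / real n" using k nX by (intro divide_left_mono) auto
      finally show "\<bar>g (Suc k) - g k\<bar> \<le> 2 / real n" .
    qed (use m in auto)
    then obtain y where y: "\<And>i :: nat. i < 300 \<Longrightarrow> n \<le> y i \<and> y i \<le> m \<and>
        \<bar>g (y i) - (g n + real i / 300 * d)\<bar> \<le> 2 / real n" by metis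
    have "\<exists>i j. i < j \<and> j < 300 \<and> \<bar>\<bar>liouville_average A (y i)\<bar> - \<bar>liouville_average A (y j)\<bar>\<bar> \<le> 4 * \<rho>"
    proof (rule X[rule_format, OF nX(1)])
      fix i :: nat assume i: "i < 300"
      have "ln (real (y i)) \<le> ln (real m)" using y[OF i] nX by simp
      thus "n \<le> y i \<and> ln (real (y i)) \<le> (1 + \<eta>) * ln (real n)" using y[OF i] m by simp
    qed
    then obtain i j where ij: "i < j" "j < 300" "\<bar>g (y i) - g (y j)\<bar> \<le> 4 * \<rho>" by (auto simp: g_def)
    have yi: "\<bar>g (y i) - (g n + real i / 300 * d)\<bar> \<le> 2 / real n"
      and yj: "\<bar>g (y j) - (g n + real j / 300 * d)\<bar> \<le> 2 / real n" using y ij by auto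
    have "\<bar>real j / 300 * d - real i / 300 * d\<bar> \<le> 4 * \<rho> + 2 * (2 / real n)"
      using yi yj ij(3) by linarith
    also have "\<dots> < r / 600 + 2 * (r / 1200)" using n1 \<rho> by linarith
    also have "real j / 300 * d - real i / 300 * d = (real j - real i) / 300 * d"
      by (simp add: algebra_simps diff_divide_distrib)
    also have "\<bar>\<dots>\<bar> = (real j - real i) / 300 * \<bar>d\<bar>" using ij by (simp add: abs_mult)
    finally have "(real j - real i) / 300 * \<bar>d\<bar> < r / 300" by simp
    moreover have "1 / 300 * r \<le> (real j - real i) / 300 * \<bar>d\<bar>"
      using ij d assms by (intro mult_mono divide_right_mono) auto
    ultimately show False by simp
  qed
  thus ?thesis using \<eta> by blast
qed

subsection \<open>Logarithmic means\<close>

definition liouville_log_sum :: "nat set \<Rightarrow> nat \<Rightarrow> real" where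
  "liouville_log_sum A n = (\<Sum>k = 1..n. liouville_in A k / real k)"

lemma liouville_log_sum_remove_prime:
  assumes "prime p" "p \<in> A"
  shows "liouville_log_sum A n + 1 / real p * liouville_log_sum A (n div p) =
         liouville_log_sum (A - {p}) n - 1 / real p * liouville_log_sum (A - {p}) (n div p)"
  using liouville_weighted_sum_remove_prime[OF assms, of "\<lambda>k. 1 / real k" n]
  by (simp add: liouville_log_sum_def)

text \<open>At most \<open>n\<close> terms separate the sums, each below p/n. Unlike for ordinary
  averages, dividing the argument by p costs only O(1), negligible against ln n.\<close>

lemma liouville_log_sum_div_close:
  assumes "p > 0"
  shows "\<bar>liouville_log_sum A n - liouville_log_sum A (n div p)\<bar> \<le> real p"
proof (cases "n = 0")
  case False
  have "liouville_log_sum A n - liouville_log_sum A (n div p) =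
        (\<Sum>k\<in>{1..n} - {1..n div p}. liouville_in A k / real k)"
    unfolding liouville_log_sum_def by (subst sum_diff) (auto intro: order.trans)
  also have "\<bar>\<dots>\<bar> \<le> (\<Sum>k\<in>{1..n} - {1..n div p}. real p / real n)"
  proof (rule order.trans[OF sum_abs sum_mono])
    fix k assume k: "k \<in> {1..n} - {1..n div p}"
    hence "n div p < k" by auto
    hence "n < p * k" using assms by (simp add: div_less_iff_less_mult mult.commute)
    hence "real n \<le> real p * real k" by (metis less_imp_le of_nat_le_iff of_nat_mult)
    thus "\<bar>liouville_in A k / real k\<bar> \<le> real p / real n"
      using k False by (simp add: field_simps)
  qed
  also have "\<dots> \<le> real n * (real p / real n)"
  proof -
    have "card ({1..n} - {1..n div p}) \<le> n"
      using card_mono[of "{1..n}" "{1..n} - {1..n div p}"] by auto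
    thus ?thesis unfolding sum_constant by (intro mult_right_mono) auto
  qed
  also have "\<dots> = real p" using False by simp
  finally show ?thesis .
qed (simp add: liouville_log_sum_def)

text \<open>Replacing \<open>n div p\<close> by \<open>n\<close> in the recursion costs a constant
  and leaves (p + 1) a = (p - 1) b + O(p), so each prime of \<open>B\<close> contributes its factor
  without any limit being taken. \<open>A\<close> varies in the induction because it loses
  \<open>p\<close>.\<close>

lemma liouville_log_sum_bound:
  assumes "finite B" "B \<subseteq> A" "\<And>p. p \<in> A \<Longrightarrow> prime p"
  shows "\<exists>C. \<forall>n\<ge>1. \<bar>liouville_log_sum A n\<bar> \<le> (\<Prod>p\<in>B. (real p - 1) / (real p + 1)) * ln (real n) + C"
  using assms
proof (induction B arbitrary: A rule: finite_induct)
  case empty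
  have "\<bar>liouville_log_sum A n\<bar> \<le> 1 * ln (real n) + 1" if "n \<ge> 1" for n
  proof -
    have "\<bar>liouville_log_sum A n\<bar> \<le> (\<Sum>k = 1..n. 1 / real k)"
      unfolding liouville_log_sum_def by (rule order.trans[OF sum_abs]) simp
    also have "\<dots> \<le> 1 + ln (real n)" using that
    proof (induction n rule: dec_induct)
      case (step k)
      have "ln (real k) - ln (real (Suc k)) \<le> (real k - real (Suc k)) / real (Suc k)"
        using step by (intro ln_diff_le) auto
      thus ?case using step by simp
    qed auto
    finally show ?thesis by simp
  qed
  thus ?case by auto
next
  case (insert p B)
  have p: "prime p" "p \<ge> 2" "p \<in> A" using insert.prems by (auto simp: prime_ge_2_nat)
  define A' where "A' = A - {p}"
  have "B \<subseteq> A'" using insert by (auto simp: A'_def)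
  then obtain C where C: "\<And>n. n \<ge> 1 \<Longrightarrow> \<bar>liouville_log_sum A' n\<bar> \<le> (\<Prod>p\<in>B. (real p - 1) / (real p + 1)) * ln (real n) + C"
    using insert.IH[of A'] insert.prems by (auto simp: A'_def)
  define c where "c = (real p - 1) / (real p + 1)"
  have c: "0 \<le> c" "c \<le> 1" using p by (auto simp: c_def)
  have "\<bar>liouville_log_sum A n\<bar> \<le> (\<Prod>p\<in>insert p B. (real p - 1) / (real p + 1)) * ln (real n) + (\<bar>C\<bar> + 2 * real p)"
    if n: "n \<ge> 1" for n
  proof -
    define a a' b b' where "a = liouville_log_sum A n" and "a' = liouville_log_sum A (n div p)"
      and "b = liouville_log_sum A' n" and "b' = liouville_log_sum A' (n div p)"
    have rec: "a + 1 / real p * a' = b - 1 / real p * b'"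
      unfolding a_def a'_def b_def b'_def A'_def by (rule liouville_log_sum_remove_prime[OF p(1,3)])
    hence "real p * (a + 1 / real p * a') = real p * (b - 1 / real p * b')" by simp
    hence "real p * a + a' = real p * b - b'" using p by (simp add: algebra_simps)
    hence "(real p + 1) * a = (real p - 1) * b + ((a - a') + (b - b'))" by (simp add: algebra_simps)
    moreover have "\<bar>a - a'\<bar> \<le> real p" "\<bar>b - b'\<bar> \<le> real p"
      using p unfolding a_def a'_def b_def b'_def by (auto intro!: liouville_log_sum_div_close)
    ultimately have "\<bar>(real p + 1) * a\<bar> \<le> \<bar>(real p - 1) * b\<bar> + 2 * real p" by linarith
    hence "(real p + 1) * \<bar>a\<bar> \<le> (real p - 1) * \<bar>b\<bar> + 2 * real p" using p by (simp add: abs_mult)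
    hence "\<bar>a\<bar> \<le> ((real p - 1) * \<bar>b\<bar> + 2 * real p) / (real p + 1)" using p by (simp add: field_simps)
    also have "\<dots> = c * \<bar>b\<bar> + 2 * real p / (real p + 1)" by (simp add: c_def add_divide_distrib)
    also have "2 * real p / (real p + 1) \<le> 2 * real p"
      using p by (simp add: field_simps)
    also have "c * \<bar>b\<bar> \<le> c * ((\<Prod>p\<in>B. (real p - 1) / (real p + 1)) * ln (real n) + \<bar>C\<bar>)"
      using C[OF n] c unfolding b_def by (intro mult_left_mono) auto
    also have "\<dots> = (\<Prod>p\<in>insert p B. (real p - 1) / (real p + 1)) * ln (real n) + c * \<bar>C\<bar>"
      using insert.hyps by (simp add: c_def algebra_simps)
    also have "c * \<bar>C\<bar> \<le> 1 * \<bar>C\<bar>" using c by (intro mult_right_mono) auto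
    finally show ?thesis by (simp add: a_def)
  qed
  thus ?case by blast
qed

text \<open>Each factor is at most 1 - 1/p <= exp(-1/p), and finite subsets of \<open>A\<close> have
  unbounded reciprocal sums.\<close>

lemma prod_euler_factor_small:
  assumes A: "\<And>p. p \<in> A \<Longrightarrow> prime p" and ns: "\<not> (\<lambda>p. 1 / real p) summable_on A" and "\<kappa> > 0"
  shows "\<exists>B. finite B \<and> B \<subseteq> A \<and> (\<Prod>p\<in>B. (real p - 1) / (real p + 1)) \<le> \<kappa>"
proof -
  have "\<exists>B. finite B \<and> B \<subseteq> A \<and> (\<Sum>p\<in>B. 1 / real p) > - ln \<kappa>"
  proof (rule ccontr)
    assume "\<not> ?thesis"
    hence "bdd_above (sum (\<lambda>p. 1 / real p) ` {F. F \<subseteq> A \<and> finite F})"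
      by (intro bdd_aboveI[of _ "- ln \<kappa>"]) (auto simp: not_less)
    hence "(\<lambda>p. 1 / real p) summable_on A"
      by (intro nonneg_bdd_above_summable_on) auto
    with ns show False by blast
  qed
  then obtain B where B: "finite B" "B \<subseteq> A" "(\<Sum>p\<in>B. 1 / real p) > - ln \<kappa>" by blast
  have "(\<Prod>p\<in>B. (real p - 1) / (real p + 1)) \<le> (\<Prod>p\<in>B. exp (- (1 / real p)))"
  proof (intro prod_mono conjI)
    fix p assume "p \<in> B"
    hence p: "p > 1" using B A prime_gt_1_nat by blast
    thus "0 \<le> (real p - 1) / (real p + 1)" by simp
    have "(real p - 1) / (real p + 1) \<le> (real p - 1) / real p"
      using p by (intro divide_left_mono) auto
    also have "\<dots> = 1 + (- (1 / real p))" using p by (simp add: diff_divide_distrib)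
    also have "\<dots> \<le> exp (- (1 / real p))" by (rule exp_ge_add_one_self)
    finally show "(real p - 1) / (real p + 1) \<le> exp (- (1 / real p))" .
  qed
  also have "\<dots> = exp (- (\<Sum>p\<in>B. 1 / real p))" using B(1) by (simp add: exp_sum sum_negf[symmetric])
  also have "\<dots> \<le> exp (ln \<kappa>)" using B(3) by (subst exp_le_cancel_iff) linarith
  also have "\<dots> = \<kappa>" using assms by simp
  finally show ?thesis using B by blast
qed

lemma liouville_log_sum_small:
  assumes A: "\<And>p. p \<in> A \<Longrightarrow> prime p" and ns: "\<not> (\<lambda>p. 1 / real p) summable_on A" and "\<kappa> > 0"
  shows "\<forall>\<^sub>F n in sequentially. \<bar>liouville_log_sum A n\<bar> \<le> \<kappa> * ln (real n)"
proof -
  obtain B where B: "finite B" "B \<subseteq> A" "(\<Prod>p\<in>B. (real p - 1) / (real p + 1)) \<le> \<kappa> / 2"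
    using prod_euler_factor_small[OF A ns, of "\<kappa> / 2"] assms(3) by auto
  obtain C where C: "\<And>n. n \<ge> 1 \<Longrightarrow> \<bar>liouville_log_sum A n\<bar> \<le> (\<Prod>p\<in>B. (real p - 1) / (real p + 1)) * ln (real n) + C"
    using liouville_log_sum_bound[OF B(1,2) A] by blast
  have "filterlim (\<lambda>n. ln (real n)) at_top sequentially"
    by (rule filterlim_compose[OF ln_at_top filterlim_real_sequentially])
  hence "\<forall>\<^sub>F n in sequentially. ln (real n) \<ge> 2 * C / \<kappa>"
    by (simp add: filterlim_at_top)
  moreover have "\<forall>\<^sub>F n in sequentially. n \<ge> (1::nat)" by (rule eventually_ge_at_top)
  ultimately show ?thesis
  proof eventually_elim
    case (elim n)
    have "(\<Prod>p\<in>B. (real p - 1) / (real p + 1)) * ln (real n) \<le> \<kappa> / 2 * ln (real n)"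
      using B(3) elim by (intro mult_right_mono) auto
    moreover have "C \<le> \<kappa> / 2 * ln (real n)" using elim assms(3) by (simp add: field_simps)
    moreover have "\<kappa> / 2 * ln (real n) + \<kappa> / 2 * ln (real n) = \<kappa> * ln (real n)" by simp
    ultimately show ?case using C[of n] elim by linarith
  qed
qed

text \<open>Partial summation: with \<open>M\<close> the average, lambda_A(k+1)/(k+1) = M(k+1) -
  M(k) + M(k)/(k+1).\<close>

lemma liouville_log_sum_diff:
  assumes "0 < n" "n \<le> m"
  shows "liouville_log_sum A m - liouville_log_sum A n =
         liouville_average A m - liouville_average A n + (\<Sum>k\<in>{n..<m}. liouville_average A k / real (Suc k))"
  using assms(2)
proof (induction m rule: dec_induct)
  case (step m)
  have "liouville_average A (Suc m) = (real m * liouville_average A m + liouville_in A (Suc m)) / real (Suc m)"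
    using step assms by (simp add: liouville_average_altdef liouville_sum_def)
  also have "\<dots> = liouville_average A m - liouville_average A m / real (Suc m) + liouville_in A (Suc m) / real (Suc m)"
  proof -
    have "real m * liouville_average A m + liouville_in A (Suc m) =
          real (Suc m) * liouville_average A m - liouville_average A m + liouville_in A (Suc m)"
      by (simp add: algebra_simps)
    thus ?thesis by (simp only:) (simp add: add_divide_distrib diff_divide_distrib del: of_nat_Suc)
  qed
  finally show ?case using step by (simp add: liouville_log_sum_def)
qed auto

lemma sum_inverse_Suc_ge:
  assumes "n \<le> m"
  shows "ln (real (Suc m)) - ln (real (Suc n)) \<le> (\<Sum>k\<in>{n..<m}. 1 / real (Suc k))"
  using assms
proof (induction m rule: dec_induct)
  case (step m)
  have "ln (real (Suc (Suc m))) - ln (real (Suc m)) \<le> (real (Suc (Suc m)) - real (Suc m)) / real (Suc m)"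
    by (intro ln_diff_le) auto
  hence "ln (real (Suc (Suc m))) - ln (real (Suc m)) \<le> 1 / real (Suc m)" by simp
  thus ?case using step by (simp del: of_nat_Suc)
qed auto

section \<open>Vanishing of the mean in the divergent case\<close>

lemma liouville_average_tendsto_0:
  assumes A: "\<And>p. p \<in> A \<Longrightarrow> prime p" and ns: "\<not> (\<lambda>p. 1 / real p) summable_on A"
  shows "liouville_average A \<longlonglongrightarrow> 0"
proof (rule LIMSEQ_I)
  fix r :: real assume r: "r > 0"
  obtain \<eta>' X where \<eta>': "\<eta>' > 0" and X': "\<And>n m. n \<ge> X \<Longrightarrow> m \<ge> n \<Longrightarrow> ln (real m) \<le> (1 + \<eta>') * ln (real n) \<Longrightarrow>
      \<bar>\<bar>liouville_average A m\<bar> - \<bar>liouville_average A n\<bar>\<bar> \<le> r / 2"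
    using abs_liouville_average_slowly_varying[of "r / 2" A] r by auto
  define \<eta> where "\<eta> = min 1 \<eta>'"
  have \<eta>: "0 < \<eta>" "\<eta> \<le> 1" using \<eta>' by (auto simp: \<eta>_def)
  \<comment> \<open>The logarithmic sums at n and m total at most 3 \<kappa> L = r \<eta> L/4, since
    \<eta> <= 1 gives ln m <= 2 L. This is half of the growth r \<eta> L/2 forced by a constant
    sign; \<open>Z\<close> handles the bounded terms.\<close>
  define \<kappa> where "\<kappa> = r * \<eta> / 12"
  have \<kappa>: "\<kappa> > 0" using r \<eta> by (simp add: \<kappa>_def)
  obtain Y where Y: "\<And>n. n \<ge> Y \<Longrightarrow> \<bar>liouville_log_sum A n\<bar> \<le> \<kappa> * ln (real n)"
    using liouville_log_sum_small[OF A ns \<kappa>] by (auto simp: eventually_at_top_linorder)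
  have "filterlim (\<lambda>n. ln (real n)) at_top sequentially"
    by (rule filterlim_compose[OF ln_at_top filterlim_real_sequentially])
  hence "\<forall>\<^sub>F n in sequentially. ln (real n) > (r / 2 + 2) * 4 / (r * \<eta>)"
    by (simp add: filterlim_at_top_dense)
  then obtain Z where Z: "\<And>n. n \<ge> Z \<Longrightarrow> ln (real n) > (r / 2 + 2) * 4 / (r * \<eta>)"
    by (auto simp: eventually_at_top_linorder)
  define N where "N = max (max X Y) (max Z (nat \<lceil>4 / r\<rceil> + 1))"
  have "\<bar>liouville_average A n\<bar> < r" if n: "n \<ge> N" for n
  proof (rule ccontr)
    assume "\<not> ?thesis"
    hence big: "\<bar>liouville_average A n\<bar> \<ge> r" by simp
    have nXYZ: "n \<ge> X" "n \<ge> Y" "n \<ge> Z" "n \<ge> 1" using n by (auto simp: N_def)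
    have "4 / r < real N" unfolding N_def by linarith
    hence "4 / r < real n" using n by linarith
    hence n1: "2 / real n < r / 2" using r nXYZ by (simp add: field_simps)
    define L where "L = ln (real n)"
    have L0: "L \<ge> 0" using nXYZ by (simp add: L_def)
    define m where "m = nat \<lfloor>exp ((1 + \<eta>) * L)\<rfloor>"
    have "exp L \<le> exp ((1 + \<eta>) * L)" using \<eta> L0 by (simp add: mult_le_cancel_right1)
    hence "real n \<le> exp ((1 + \<eta>) * L)" using nXYZ by (simp add: L_def)
    hence nm: "n \<le> m" by (simp add: m_def le_nat_floor)
    have m_le: "real m \<le> exp ((1 + \<eta>) * L)" and m_ge: "exp ((1 + \<eta>) * L) \<le> real (Suc m)"
      unfolding m_def by (simp, linarith)
    have lnm: "ln (real m) \<le> (1 + \<eta>) * L" "(1 + \<eta>) * L \<le> ln (real (Suc m))"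
      using m_le m_ge nm nXYZ by (auto simp: ln_ge_iff intro!: ln_le_of_le_exp)
    define \<sigma> where "\<sigma> = sgn (liouville_average A n)"
    have \<sigma>: "\<bar>\<sigma>\<bar> = 1" "\<sigma> * liouville_average A n = \<bar>liouville_average A n\<bar>"
      using big r by (auto simp: \<sigma>_def sgn_if)
    have half: "\<bar>liouville_average A k\<bar> \<ge> r / 2" if k: "n \<le> k" "k \<le> m" for k
    proof -
      have "ln (real k) \<le> ln (real m)" using k nXYZ by simp
      also have "\<dots> \<le> (1 + \<eta>) * L" by (rule lnm)
      also have "\<dots> \<le> (1 + \<eta>') * L" using L0 by (intro mult_right_mono) (auto simp: \<eta>_def)
      finally have "\<bar>\<bar>liouville_average A k\<bar> - \<bar>liouville_average A n\<bar>\<bar> \<le> r / 2"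
        using k nXYZ unfolding L_def by (intro X') auto
      thus ?thesis using big by linarith
    qed
    \<comment> \<open>A sign change would have to jump from at least r/2 to at most -r/2, but the
      steps are shorter than r/2.\<close>
    have signed: "\<sigma> * liouville_average A k \<ge> r / 2" if "n \<le> k" "k \<le> m" for k
      using that
    proof (induction k rule: dec_induct)
      case base
      show ?case using \<sigma> big r by simp
    next
      case (step k)
      have IH: "\<sigma> * liouville_average A k \<ge> r / 2" using step by simp
      have "\<bar>liouville_average A (Suc k) - liouville_average A k\<bar> \<le> 2 / real k"
        using step nXYZ by (intro liouville_average_step) auto
      also have "2 / real k \<le> 2 / real n" using step nXYZ by (intro divide_left_mono) auto
      finally have "\<bar>\<sigma> * liouville_average A (Suc k) - \<sigma> * liouville_average A k\<bar> < r / 2"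
        using n1 \<sigma>(1) by (simp add: right_diff_distrib[symmetric] abs_mult)
      moreover have "\<bar>\<sigma> * liouville_average A (Suc k)\<bar> \<ge> r / 2"
        using half[of "Suc k"] step \<sigma>(1) by (simp add: abs_mult)
      ultimately show ?case using IH r by linarith
    qed
    define S where "S = (\<Sum>k\<in>{n..<m}. 1 / real (Suc k))"
    have "r / 2 * S \<le> (\<Sum>k\<in>{n..<m}. \<sigma> * liouville_average A k / real (Suc k))"
      unfolding S_def sum_distrib_left
    proof (intro sum_mono)
      fix k assume "k \<in> {n..<m}"
      hence "r / 2 \<le> \<sigma> * liouville_average A k" using signed[of k] by simp
      hence "r / 2 / real (Suc k) \<le> \<sigma> * liouville_average A k / real (Suc k)"
        by (intro divide_right_mono) auto
      thus "r / 2 * (1 / real (Suc k)) \<le> \<sigma> * liouville_average A k / real (Suc k)" by simp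
    qed
    also have "\<dots> = \<sigma> * (liouville_log_sum A m - liouville_log_sum A n - (liouville_average A m - liouville_average A n))"
      using liouville_log_sum_diff[of n m A] nm nXYZ by (simp add: sum_distrib_left)
    also have "\<dots> \<le> \<bar>liouville_log_sum A m - liouville_log_sum A n - (liouville_average A m - liouville_average A n)\<bar>"
      using \<sigma>(1) abs_ge_self[of "\<sigma> * (liouville_log_sum A m - liouville_log_sum A n - (liouville_average A m - liouville_average A n))"]
      by (simp add: abs_mult)
    also have "\<dots> \<le> \<bar>liouville_log_sum A m\<bar> + \<bar>liouville_log_sum A n\<bar> + 2"
      using abs_liouville_average_le[of A m] abs_liouville_average_le[of A n] by linarith
    also have "\<bar>liouville_log_sum A m\<bar> \<le> \<kappa> * (2 * L)"
    proof -
      have "\<bar>liouville_log_sum A m\<bar> \<le> \<kappa> * ln (real m)" using nXYZ nm by (intro Y) auto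
      also have "(1 + \<eta>) * L \<le> 2 * L" using \<eta> L0 by (intro mult_right_mono) auto
      hence "\<kappa> * ln (real m) \<le> \<kappa> * (2 * L)" using lnm \<kappa> by (intro mult_left_mono) auto
      finally show ?thesis .
    qed
    also have "\<bar>liouville_log_sum A n\<bar> \<le> \<kappa> * L" using Y[OF nXYZ(2)] by (simp add: L_def)
    finally have upper: "r / 2 * S \<le> 3 * \<kappa> * L + 2" by (simp add: mult.commute[of L])
    have "ln (real (Suc n)) \<le> L + 1"
    proof -
      have "ln (real (Suc n)) - ln (real n) \<le> (real (Suc n) - real n) / real n"
        using nXYZ by (intro ln_diff_le) auto
      also have "\<dots> \<le> 1" using nXYZ by simp
      finally show ?thesis by (simp add: L_def)
    qed
    hence "(1 + \<eta>) * L - (L + 1) \<le> S"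
      using sum_inverse_Suc_ge[OF nm] lnm unfolding S_def by linarith
    hence "\<eta> * L - 1 \<le> S" by (simp add: algebra_simps)
    hence "r / 2 * (\<eta> * L - 1) \<le> r / 2 * S" using r by (intro mult_left_mono) auto
    with upper have "r / 2 * (\<eta> * L - 1) \<le> 3 * \<kappa> * L + 2" by linarith
    hence "r * \<eta> * L \<le> (r / 2 + 2) * 4" by (simp add: \<kappa>_def algebra_simps)
    moreover have "(r / 2 + 2) * 4 < r * \<eta> * L"
      using Z[OF nXYZ(3)] r \<eta> by (simp add: L_def pos_divide_less_eq mult_ac)
    ultimately show False by linarith
  qed
  thus "\<exists>no. \<forall>n\<ge>no. norm (liouville_average A n - 0) < r" by auto
qed

theorem theorem2:
  fixes A :: "nat set"
  assumes "\<And>p. p \<in> A \<Longrightarrow> prime p"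
  shows "convergent (liouville_average A) \<and>
    (if (\<lambda>p. 1 / real p) summable_on A
     then euler_factor_in A has_prod liouville_mean A
     else liouville_mean A = 0)"
proof (cases "(\<lambda>p. 1 / real p) summable_on A")
  case True
  then obtain R where "euler_factor_in A has_prod R" "liouville_average A \<longlonglongrightarrow> R"
    using liouville_average_tendsto_euler_product[OF assms] by blast
  thus ?thesis using True by (auto simp: liouville_mean_def limI convergentI)
next
  case False
  hence "liouville_average A \<longlonglongrightarrow> 0" using liouville_average_tendsto_0[OF assms] by blast
  thus ?thesis using False by (auto simp: liouville_mean_def limI convergentI)
qed

end
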